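(* Let $k\geq 0$ be an integer and let $M=2^k+1$. Then for any collection $\Phi=\{P_1,\ldots,P_N\}$ of $N\leq 2M-2$ orthogonal projections of $\mathbb{R}^M$ onto proper linear subspaces, the map $\mathcal{A}_\Phi$ is not injective.
   Context: $\langle\cdot,\cdot\rangle$ is the standard inner product on $\mathbb{R}^M$. For a collection $\Phi=\{P_1,\ldots,P_N\}$ of orthogonal projections of $\mathbb{R}^M$, the map $\mathcal{A}_\Phi\colon(\mathbb{R}^M\smallsetminus\{0\})/\pm1\to\mathbb{R}_{\geq0}^N$ is defined by $x\mapsto(\langle P_1x,P_1x\rangle,\ldots,\langle P_Nx,P_Nx\rangle)$, where $(\mathbb{R}^M\smallsetminus\{0\})/\pm1$ is the quotient identifying $x$ with $-x$. *)

theory Defs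
  imports "HOL-Analysis.Analysis"
begin

definition orthogonal_projection_onto :: "'a::euclidean_space set \<Rightarrow> ('a \<Rightarrow> 'a) \<Rightarrow> bool" where
  "orthogonal_projection_onto S P \<longleftrightarrow>
     subspace S \<and> (\<forall>x. P x \<in> S \<and> x - P x \<in> orthogonal_comp S)"

definition pm_rel :: "('a::real_vector \<times> 'a) set" where
  "pm_rel = {(x, y). x \<noteq> 0 \<and> y \<noteq> 0 \<and> (y = x \<or> y = - x)}"

definition nonzero_mod_pm :: "'a::real_vector set set" where
  "nonzero_mod_pm = (UNIV - {0}) // pm_rel"

text \<open>A collection of \<open>N\<close> projections is a list of length \<open>N\<close> (repetitions allowed),
  and the vector of its \<open>N\<close> measurements is the corresponding list of reals.\<close>

definition norm_measurements :: "('a::real_inner \<Rightarrow> 'a) list \<Rightarrow> 'a \<Rightarrow> real list" where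
  "norm_measurements \<Phi> x = map (\<lambda>P. P x \<bullet> P x) \<Phi>"

text \<open>The map induced on the quotient. The value on a class is the common value of
  \<^const>\<open>norm_measurements\<close> at its members; for linear maps \<open>\<Phi>\<close> this
  is well defined, see \<open>measurement_map_class\<close> below.\<close>

definition measurement_map :: "('a::real_inner \<Rightarrow> 'a) list \<Rightarrow> 'a set \<Rightarrow> real list" where
  "measurement_map \<Phi> X = the_elem (norm_measurements \<Phi> ` X)"

lemma equiv_pm_rel: "equiv (UNIV - {0}) pm_rel"
  by (rule equivI) (auto simp: pm_rel_def refl_on_def sym_def trans_def)

lemma orthogonal_projection_onto_unique:
  assumes "orthogonal_projection_onto S P" and "y \<in> S" and "x - y \<in> orthogonal_comp S"
  shows "P x = y"
proof -
  have S: "subspace S" and 1: "P x \<in> S" "x - P x \<in> orthogonal_comp S"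
    using assms(1) by (auto simp: orthogonal_projection_onto_def)
  have "P x - y \<in> S"
    using S 1(1) assms(2) by (rule subspace_diff)
  moreover have "(x - y) - (x - P x) \<in> orthogonal_comp S"
    using subspace_orthogonal_comp assms(3) 1(2) by (rule subspace_diff)
  hence "P x - y \<in> orthogonal_comp S" by simp
  ultimately have "(P x - y) \<bullet> (P x - y) = 0"
    by (auto simp: orthogonal_comp_def orthogonal_def)
  thus ?thesis by simp
qed

lemma orthogonal_projection_onto_minus:
  assumes "orthogonal_projection_onto S P"
  shows "P (- x) = - P x"
proof (rule orthogonal_projection_onto_unique[OF assms])
  have S: "subspace S" and 1: "P x \<in> S" "x - P x \<in> orthogonal_comp S"
    using assms by (auto simp: orthogonal_projection_onto_def)
  show "- P x \<in> S" using subspace_neg[OF S 1(1)] .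
  show "- x - - P x \<in> orthogonal_comp S"
    using subspace_neg[OF subspace_orthogonal_comp 1(2)] by simp
qed

lemma measurement_map_class:
  assumes "\<And>P. P \<in> set \<Phi> \<Longrightarrow> \<exists>S. orthogonal_projection_onto S P" and "x \<noteq> 0"
  shows "measurement_map \<Phi> (pm_rel `` {x}) = norm_measurements \<Phi> x"
proof -
  have "norm_measurements \<Phi> (- x) = norm_measurements \<Phi> x"
    using assms(1) orthogonal_projection_onto_minus by (fastforce simp: norm_measurements_def)
  moreover have "pm_rel `` {x} = {x, - x}"
    using assms(2) by (auto simp: pm_rel_def)
  ultimately show ?thesis by (simp add: measurement_map_def)
qed

end

theory Submission
  imports Defs "HOL-Library.Function_Algebras" "Jordan_Normal_Form.Char_Poly" "HOL-Real_Asymp.Real_Asymp"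
begin

text \<open>
  With \<open>M = m + 1\<close>, polarisation turns non-injectivity into the existence of a symmetric matrix
  \<open>A \<noteq> 0\<close> of rank at most two that is annihilated by \<open>2 m\<close> symmetric bilinear forms: over the complex
  numbers, symmetrised pairs \<open>{x, y}\<close> form a projective variety of dimension \<open>2 m\<close> and of
  degree \<open>e = (2 m choose m) / 2\<close>, and \<open>e\<close> is odd precisely for \<open>m = 2 ^ k\<close>; an odd number
  of solutions forces a real one.

  This count is made algebraic through the graded ring \<open>S\<close> generated by the symmetric bilinear
  functions \<open>(x, y) \<mapsto> f x * g y + f y * g x\<close>. For a generic system \<open>B\<close> of \<open>2 m\<close> elements of degree one, the
  quotient of \<open>S\<close> by the ideal of \<open>B\<close> has dimension exactly \<open>e\<close> in high degrees. The upper bound is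
  checked for the split system \<open>L i x * L i y\<close> with linear forms in general position and
  carries over to all but finitely many members of a pencil; the lower bound is the growth of
  the Hilbert function of \<open>S\<close>. Multiplication by the elements of degree one, divided by a
  fixed one, yields commuting operators on a real space of odd dimension \<open>e\<close>. They have a
  common eigenvector, whose eigenvalues are the entries of a matrix of rank at most
  two. A compactness argument along the pencil removes the genericity assumption.
\<close>

text \<open>The count has to be exact: a quotient of dimension merely at most \<open>e\<close> could
  be even-dimensional, and commuting operators on it need not have a real eigenvector. The number
  \<open>2 * m choose m\<close> is the top self-intersection of the hyperplane class on ordered
  pairs of points of projective \<open>m\<close>-space; exchanging the two points halves it. For a
  special system the quotient can be larger, for instance when the solutions form a curve, hence the
  detour through a pencil.

  A real solution comes either from two real vectors or from a complex conjugate pair, and only the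
  symmetrised matrix is real in both cases; therefore solutions are matrices and not pairs of
  vectors. An indefinite one is a multiple of \<open>a a^T - c c^T\<close>, and being annihilated by
  the form of a projection \<open>P\<close> says that \<open>P a\<close> and \<open>P c\<close> have
  equal norm. A semidefinite one forces \<open>P a = 0\<close> for every \<open>P\<close>, and then
  \<open>a\<close> and its multiples are indistinguishable.\<close>

unbundle no vec_syntax
no_notation Matrix.scalar_prod (infix \<open>\<bullet>\<close> 70)

subsection \<open>Linear algebra\<close>

text \<open>Pointwise operations make the functions on pairs of vectors a commutative real algebra,
  so that ideals, spans and graded pieces all live in one type.\<close>

instantiation "fun" :: (type, real_vector) real_vector
begin

definition scaleR_fun :: "real \<Rightarrow> ('a \<Rightarrow> 'b) \<Rightarrow> 'a \<Rightarrow> 'b" where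
  "scaleR_fun c f = (\<lambda>x. c *\<^sub>R f x)"

instance
  by standard (auto simp: scaleR_fun_def algebra_simps)

end

instance "fun" :: (type, real_algebra) real_algebra
  by standard (auto simp: scaleR_fun_def fun_eq_iff)

instance "fun" :: (type, real_algebra_1) real_algebra_1 ..

lemma odd_degree_real_root:
  fixes p :: "real poly"
  assumes "odd (degree p)"
  shows "\<exists>x. poly p x = 0"
proof -
  have *: "\<exists>x. poly q x = 0" if "odd (degree q)" and pos: "lead_coeff q > 0" for q :: "real poly"
  proof -
    obtain b where "\<forall>x\<ge>b. poly q x \<ge> lead_coeff q"
      using poly_pinfty_gt_lc[OF pos] by blast
    then have b: "poly q b > 0" using pos by (meson less_le_trans order_refl)
    define r where "r = pcompose (- q) [:0, -1:]"
    have "lead_coeff r > 0"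
      using that lead_coeff_comp[of "[:0, -1:]" "- q"] by (simp add: r_def)
    then obtain c where "\<forall>x\<ge>c. poly r x \<ge> lead_coeff r"
      using poly_pinfty_gt_lc by blast
    then have "poly r c > 0" using \<open>lead_coeff r > 0\<close> by (meson less_le_trans order_refl)
    then have a: "poly q (- c) < 0" by (simp add: r_def poly_pcompose)
    define a where "a = - c"
    note a = a[folded a_def]
    have cont: "continuous_on X (poly q)" for X
      by (intro continuous_at_imp_continuous_on ballI poly_isCont)
    show ?thesis
    proof (cases "a \<le> b")
      case True
      show ?thesis using IVT'[of "poly q" a 0 b] a b True cont by auto
    next
      case False
      show ?thesis using IVT2'[of "poly q" a 0 b] a b False cont by auto
    qed
  qed
  have "lead_coeff p \<noteq> 0" using assms by auto
  then show ?thesis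
    using *[of p] *[of "- p"] assms
    by (cases "lead_coeff p" "0::real" rule: linorder_cases) auto
qed

text \<open>In coordinates given by \<open>B\<close> the map is a matrix of odd size, whose
  characteristic polynomial has odd degree and hence a real root. An invariant span stands in for
  the whole space because function spaces are infinite-dimensional.\<close>

lemma odd_dim_eigenvector:
  fixes f :: "'v::real_vector \<Rightarrow> 'v"
  assumes f: "linear f" and B: "finite B" "independent B" "odd (card B)"
    and inv: "f ` span B \<subseteq> span B"
  obtains v \<mu> where "v \<in> span B" "v \<noteq> 0" "f v = \<mu> *\<^sub>R v"
proof -
  define n where "n = card B"
  obtain b where b: "bij_betw b {..<n} B"
    using ex_bij_betw_nat_finite[OF B(1)] by (auto simp: n_def atLeast0LessThan)
  then have bB: "b ` {..<n} = B" by (simp add: bij_betw_def)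
  have "\<exists>a. f (b j) = (\<Sum>i<n. a i *\<^sub>R b i)" if "j < n" for j
  proof -
    have "f (b j) \<in> span B" using inv bB that by (auto intro: span_base)
    then obtain u where "f (b j) = (\<Sum>v\<in>B. u v *\<^sub>R v)"
      using span_finite[OF B(1)] by auto
    also have "\<dots> = (\<Sum>i<n. u (b i) *\<^sub>R b i)"
      by (rule sum.reindex_bij_betw[OF b, symmetric, of "\<lambda>v. u v *\<^sub>R v"])
    finally show ?thesis by (intro exI[of _ "\<lambda>i. u (b i)"])
  qed
  note ex = this
  define a where "a = (\<lambda>i j. (SOME c. f (b j) = (\<Sum>i<n. c i *\<^sub>R b i)) i)"
  have a: "f (b j) = (\<Sum>i<n. a i j *\<^sub>R b i)" if "j < n" for j
    unfolding a_def by (rule someI_ex[OF ex[OF that]])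
  define A where "A = mat n n (\<lambda>(i, j). a i j)"
  have A: "A \<in> carrier_mat n n" by (simp add: A_def)
  obtain \<mu> where "poly (char_poly A) \<mu> = 0"
    using odd_degree_real_root[of "char_poly A"] degree_monic_char_poly[OF A] B(3)
    by (auto simp: n_def)
  then obtain w where w: "w \<in> carrier_vec n" "w \<noteq> 0\<^sub>v n" "A *\<^sub>v w = \<mu> \<cdot>\<^sub>v w"
    using eigenvalue_root_char_poly[OF A] A by (auto simp: eigenvalue_def eigenvector_def)
  have Aw: "(\<Sum>j<n. a i j * (w $ j)) = \<mu> * w $ i" if "i < n" for i
  proof -
    have "(A *\<^sub>v w) $ i = (\<mu> \<cdot>\<^sub>v w) $ i" using w by simp
    then show ?thesis using that w(1) A
      by (simp add: A_def scalar_prod_def atLeast0LessThan)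
  qed
  define v where "v = (\<Sum>j<n. (w $ j) *\<^sub>R b j)"
  have "v \<in> span B" unfolding v_def by (intro span_sum span_scale span_base) (use bB in auto)
  moreover have "v \<noteq> 0"
  proof
    assume "v = 0"
    have "v = (\<Sum>x\<in>B. (w $ inv_into {..<n} b x) *\<^sub>R x)"
      unfolding v_def using b
      by (subst sum.reindex_bij_betw[OF b, symmetric])
        (auto intro!: sum.cong simp: bij_betw_def inv_into_f_f)
    with \<open>v = 0\<close> have "\<forall>x\<in>B. w $ inv_into {..<n} b x = 0"
      using independent_explicit_finite_subsets[of B] B
      by (metis B(1) B(2) order_refl)
    then have "w $ j = 0" if "j < n" for j
      using that b bB by (metis bij_betw_def imageI inv_into_f_f lessThan_iff)
    then show False using w(1,2) by auto
  qed
  moreover have "f v = \<mu> *\<^sub>R v"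
  proof -
    have "f v = (\<Sum>j<n. (w $ j) *\<^sub>R (\<Sum>i<n. a i j *\<^sub>R b i))"
      unfolding v_def by (simp add: linear_sum[OF f] linear_scale[OF f] a)
    also have "\<dots> = (\<Sum>i<n. (\<Sum>j<n. a i j * (w $ j)) *\<^sub>R b i)"
      by (simp add: scaleR_sum_right scaleR_sum_left mult.commute) (rule sum.swap)
    also have "\<dots> = \<mu> *\<^sub>R v"
      by (simp add: Aw v_def scaleR_sum_right)
    finally show ?thesis .
  qed
  ultimately show thesis using that by blast
qed

lemma finite_indep_in_span:
  fixes B :: "'v::real_vector set"
  assumes "finite B" "independent K" "K \<subseteq> span B"
  shows "finite K" "card K \<le> card B"
  using independent_span_bound[OF assms] by auto

lemma disjoint_spans_eq_0:
  fixes C K :: "'v::real_vector set"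
  assumes "independent (C \<union> K)" "finite C" "finite K" "C \<inter> K = {}" "v \<in> span C" "v \<in> span K"
  shows "v = 0"
proof -
  obtain u where u: "v = (\<Sum>x\<in>C. u x *\<^sub>R x)" using span_finite[OF assms(2)] assms(5) by auto
  obtain w where w: "v = (\<Sum>x\<in>K. w x *\<^sub>R x)" using span_finite[OF assms(3)] assms(6) by auto
  define z where "z x = (if x \<in> C then u x else - w x)" for x
  have "(\<Sum>x\<in>C \<union> K. z x *\<^sub>R x) = (\<Sum>x\<in>C. z x *\<^sub>R x) + (\<Sum>x\<in>K. z x *\<^sub>R x)"
    using assms by (simp add: sum.union_disjoint)
  also have "(\<Sum>x\<in>C. z x *\<^sub>R x) = v" unfolding u by (intro sum.cong) (auto simp: z_def)
  also have "(\<Sum>x\<in>K. z x *\<^sub>R x) = - v" unfolding w sum_negf[symmetric]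
    using assms(4) by (intro sum.cong) (auto simp: z_def)
  finally have "(\<Sum>x\<in>C \<union> K. z x *\<^sub>R x) = 0" by simp
  then have "\<forall>x\<in>C \<union> K. z x = 0"
    using assms(1-3) dependent_finite[of "C \<union> K"] by auto
  then have "u x = 0" if "x \<in> C" for x using that by (metis UnCI z_def)
  then show ?thesis by (simp add: u)
qed

text \<open>Rank-nullity on a finite-dimensional span, stated with bases so that the parities of the
  two dimensions can be compared. A basis of the kernel is extended to one of the span, and
  \<open>g\<close> is injective on the span of the added vectors.\<close>

lemma kernel_image_bases:
  fixes g :: "'v::real_vector \<Rightarrow> 'v"
  assumes g: "linear g" and B: "finite B" "independent B"
  obtains K R where "finite K" "independent K" "span K = {v \<in> span B. g v = 0}"
    "finite R" "independent R" "span R = g ` span B" "card K + card R = card B"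
proof -
  define U where "U = {v \<in> span B. g v = 0}"
  have U: "subspace U"
    unfolding U_def subspace_def
    by (auto simp: span_zero span_add span_scale linear_add[OF g] linear_scale[OF g] linear_0[OF g])
  obtain K where K: "K \<subseteq> U" "independent K" "U \<subseteq> span K"
    by (rule basis_exists[of U])
  have spK: "span K = U" using K(1,3) U by (meson span_minimal subset_antisym)
  have "K \<subseteq> span B" using K(1) by (auto simp: U_def)
  then obtain B' where B': "K \<subseteq> B'" "B' \<subseteq> span B" "independent B'" "span B \<subseteq> span B'"
    using maximal_independent_subset_extend[OF _ K(2)] by blast
  have spB: "span B' = span B"
    using B'(2,4) by (metis span_minimal subspace_span subset_antisym)
  have fB': "finite B'" using finite_indep_in_span[OF B(1) B'(3,2)] by simp
  have cB': "card B' = card B"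
    using spB B(2) B'(3) by (metis dim_span_eq_card_independent)
  define C where "C = B' - K"
  have inj: "inj_on g (span C)"
  proof (rule linear_inj_on_iff_eq_0[OF g subspace_span, THEN iffD2], safe)
    fix v assume v: "v \<in> span C" "g v = 0"
    have "v \<in> span B" using v(1) spB span_mono[of C B'] by (auto simp: C_def)
    then have "v \<in> span K" using v(2) spK by (simp add: U_def)
    show "v = 0"
      by (rule disjoint_spans_eq_0[OF _ _ _ _ v(1) \<open>v \<in> span K\<close>])
        (use fB' B'(1,3) in \<open>auto simp: C_def Un_absorb2 finite_subset\<close>)
  qed
  show thesis
  proof
    show "finite K" using B'(1) fB' finite_subset by blast
    show "independent K" by (fact K)
    show "span K = {v \<in> span B. g v = 0}" using spK by (simp add: U_def)
    show "finite (g ` C)" using fB' by (simp add: C_def)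
    have "independent C" using independent_mono[OF B'(3)] by (auto simp: C_def)
    then show "independent (g ` C)"
      using linear_independent_injective_image[OF g] inj by blast
    have "g ` span B = span (g ` B')" using spB linear_span_image[OF g] by metis
    also have "\<dots> = span (g ` C)"
    proof
      have "g ` B' \<subseteq> span (g ` C)"
        using K(1) by (auto simp: C_def U_def span_zero intro: span_base) (metis (mono_tags, lifting) Diff_iff K(1) U_def image_eqI mem_Collect_eq span_base span_zero subsetD)
      then show "span (g ` B') \<subseteq> span (g ` C)" by (simp add: span_minimal)
      show "span (g ` C) \<subseteq> span (g ` B')" by (rule span_mono) (auto simp: C_def)
    qed
    finally show "span (g ` C) = g ` span B" ..
    have "card (g ` C) = card C"
      using inj inj_on_subset span_superset card_image by metis
    then show "card K + card (g ` C) = card B"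
      using cB' B'(1) fB' card_mono[OF fB' B'(1)] by (simp add: C_def card_Diff_subset finite_subset)
  qed
qed

text \<open>Induction on the dimension. If some \<open>T s\<close> is not scalar, it has a real
  eigenvalue \<open>\<mu>\<close>; kernel and image of \<open>T s - \<mu>\<close> are proper,
  nonzero and, by commutation, invariant under all operators. Their dimensions add up to an odd
  number, so the induction applies to one of them.\<close>

lemma common_eigenvector:
  fixes T :: "'i \<Rightarrow> 'v::real_vector \<Rightarrow> 'v"
  assumes "\<And>i. linear (T i)" "finite B" "independent B" "odd (card B)"
    and "\<And>i. T i ` span B \<subseteq> span B"
    and "\<And>i j v. v \<in> span B \<Longrightarrow> T i (T j v) = T j (T i v)"
  shows "\<exists>q \<in> span B. q \<noteq> 0 \<and> (\<forall>i. \<exists>c. T i q = c *\<^sub>R q)"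
  using assms(2-)
proof (induction "card B" arbitrary: B rule: less_induct)
  case less
  note lin = assms(1)
  show ?case
  proof (cases "\<forall>i. \<exists>c. \<forall>v \<in> span B. T i v = c *\<^sub>R v")
    case True
    obtain q where q: "q \<in> B" using less.prems(3) by (cases "B = {}") auto
    then have "q \<noteq> 0" using less.prems(2) dependent_zero by blast
    then show ?thesis using True q span_base[OF q] by metis
  next
    case False
    then obtain s where s: "\<And>c. \<exists>v \<in> span B. T s v \<noteq> c *\<^sub>R v" by blast
    obtain v0 \<mu> where v0: "v0 \<in> span B" "v0 \<noteq> 0" "T s v0 = \<mu> *\<^sub>R v0"
      using odd_dim_eigenvector[OF lin less.prems(1,2,3,4)] by blast
    define g where "g = (\<lambda>v. T s v - \<mu> *\<^sub>R v)"
    have g: "linear g"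
      unfolding g_def using lin by (intro linear_compose_sub lin linear_compose_scale_right linear_ident)
    have gT: "g (T i v) = T i (g v)" if "v \<in> span B" for i v
      using less.prems(5)[OF that] by (simp add: g_def linear_diff[OF lin] linear_scale[OF lin])
    obtain K R where KR: "finite K" "independent K" "span K = {v \<in> span B. g v = 0}"
      "finite R" "independent R" "span R = g ` span B" "card K + card R = card B"
      using kernel_image_bases[OF g less.prems(1,2)] by blast
    have gB: "g ` span B \<subseteq> span B"
      using less.prems(4) by (auto simp: g_def intro!: span_diff span_scale)
    have "card K \<noteq> 0"
    proof
      assume "card K = 0"
      then have "span K = {0}" using KR(1) by simp
      then show False using v0 KR(3) by (auto simp: g_def)
    qed
    have "card R \<noteq> 0"
    proof
      assume "card R = 0"
      then have "span R = {0}" using KR(4) by simp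
      then have "\<forall>v\<in>span B. g v = 0" using KR(6) by blast
      then show False using s[of \<mu>] by (auto simp: g_def)
    qed
    have KB: "span K \<subseteq> span B" and RB: "span R \<subseteq> span B" using KR gB by auto
    have "odd (card K) \<or> odd (card R)" using KR(7) less.prems(3) by presburger
    then show ?thesis
    proof
      assume o: "odd (card K)"
      have "\<exists>q \<in> span K. q \<noteq> 0 \<and> (\<forall>i. \<exists>c. T i q = c *\<^sub>R q)"
      proof (rule less.hyps)
        show "card K < card B" using KR(7) \<open>card R \<noteq> 0\<close> by simp
        show "T i ` span K \<subseteq> span K" for i
        proof safe
          fix v assume "v \<in> span K"
          then have v: "v \<in> span B" "g v = 0" using KR(3) by auto
          then have "T i v \<in> span B" using less.prems(4) by blast
          then show "T i v \<in> span K" using KR(3) v gT[OF v(1)] linear_0[OF lin] by simp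
        qed
      qed (use KR o KB less.prems in auto)
      then show ?thesis using KB by blast
    next
      assume o: "odd (card R)"
      have "\<exists>q \<in> span R. q \<noteq> 0 \<and> (\<forall>i. \<exists>c. T i q = c *\<^sub>R q)"
      proof (rule less.hyps)
        show "card R < card B" using KR(7) \<open>card K \<noteq> 0\<close> by simp
        show "T i ` span R \<subseteq> span R" for i
        proof safe
          fix v assume "v \<in> span R"
          then obtain u where u: "u \<in> span B" "v = g u" using KR(6) by auto
          then have "T i u \<in> span B" using less.prems(4) by blast
          then show "T i v \<in> span R" using KR(6) u gT[OF u(1)] by (metis imageI)
        qed
      qed (use KR o RB less.prems in auto)
      then show ?thesis using RB by blast
    qed
  qed
qed

text \<open>The perturbed vectors arise from the \<open>b j\<close> through the matrix
  \<open>t + E\<close>, which is invertible unless \<open>t\<close> is an eigenvalue of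
  \<open>- E\<close>. Outside these finitely many values the inverse matrix writes each
  \<open>b a\<close> as a combination of vectors of \<open>Y t\<close>.\<close>

lemma generic_perturbation:
  fixes b :: "nat \<Rightarrow> 'v::real_vector" and Y :: "real \<Rightarrow> 'v set"
  assumes Y: "\<And>t. subspace (Y t)"
    and mem: "\<And>t a. a < D \<Longrightarrow> t *\<^sub>R b a + (\<Sum>j<D. E a j *\<^sub>R b j) \<in> Y t"
  shows "finite {t. \<exists>a<D. b a \<notin> Y t}"
proof -
  define A where "A = mat D D (\<lambda>(i, j). - E i j)"
  have A: "A \<in> carrier_mat D D" by (simp add: A_def)
  have "char_poly A \<noteq> 0" using degree_monic_char_poly[OF A] by auto
  then have fin: "finite {t. poly (char_poly A) t = 0}" by (rule poly_roots_finite)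
  have "b a \<in> Y t" if t: "poly (char_poly A) t \<noteq> 0" and a: "a < D" for t a
  proof -
    define W where "W = mat D D (\<lambda>(i, j). (if i = j then t else 0) + E i j)"
    have W: "W \<in> carrier_mat D D" by (simp add: W_def)
    have "det W \<noteq> 0"
    proof
      assume "det W = 0"
      then obtain v where v: "v \<in> carrier_vec D" "v \<noteq> 0\<^sub>v D" "W *\<^sub>v v = 0\<^sub>v D"
        using det_0_iff_vec_prod_zero_field[OF W] by blast
      have "A *\<^sub>v v = t \<cdot>\<^sub>v v"
      proof
        fix i assume i: "i < dim_vec (t \<cdot>\<^sub>v v)"
        then have i: "i < D" using v by simp
        have "(W *\<^sub>v v) $ i = 0" using v i by simp
        then have "(\<Sum>j<D. ((if i = j then t else 0) + E i j) * v $ j) = 0"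
          using i v(1) by (simp add: W_def scalar_prod_def atLeast0LessThan)
        then have "t * v $ i + (\<Sum>j<D. E i j * v $ j) = 0"
          using i by (simp add: distrib_right sum.distrib if_distrib[of "\<lambda>x. x * _"] cong: if_cong)
        then show "(A *\<^sub>v v) $ i = (t \<cdot>\<^sub>v v) $ i"
          using i v(1) by (simp add: A_def scalar_prod_def atLeast0LessThan sum_negf)
      qed (use v A in auto)
      then have "eigenvalue A t" using v A by (auto simp: eigenvalue_def eigenvector_def)
      then show False using eigenvalue_root_char_poly[OF A] t by simp
    qed
    then obtain V where V: "V \<in> carrier_mat D D" "V * W = 1\<^sub>m D"
      using det_non_zero_imp_unit[OF W] by (auto simp: Units_def ring_mat_def)
    have VW: "(\<Sum>c<D. V $$ (a, c) * ((if c = j then t else 0) + E c j)) = (if a = j then 1 else 0)"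
      if "j < D" for j
    proof -
      have "(V * W) $$ (a, j) = (if a = j then 1 else 0)" using V a that by simp
      then show ?thesis using V(1) W a that
        by (simp add: W_def scalar_prod_def atLeast0LessThan)
    qed
    have "(\<Sum>c<D. V $$ (a, c) *\<^sub>R (t *\<^sub>R b c + (\<Sum>j<D. E c j *\<^sub>R b j)))
        = (\<Sum>c<D. V $$ (a, c) *\<^sub>R (\<Sum>j<D. ((if c = j then t else 0) + E c j) *\<^sub>R b j))"
      by (intro sum.cong refl arg_cong2[where f = scaleR])
        (simp add: scaleR_left_distrib sum.distrib if_distrib[of "\<lambda>x. x *\<^sub>R _"] cong: if_cong)
    also have "\<dots> = (\<Sum>j<D. (\<Sum>c<D. V $$ (a, c) * ((if c = j then t else 0) + E c j)) *\<^sub>R b j)"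
      by (simp add: scaleR_sum_right scaleR_sum_left) (rule sum.swap)
    also have "\<dots> = (\<Sum>j<D. (if a = j then 1 else 0) *\<^sub>R b j)"
      by (intro sum.cong refl) (simp add: VW)
    also have "\<dots> = b a"
      using a by (simp add: if_distrib[of "\<lambda>x. x *\<^sub>R _"] cong: if_cong)
    finally have eq: "b a = (\<Sum>c<D. V $$ (a, c) *\<^sub>R (t *\<^sub>R b c + (\<Sum>j<D. E c j *\<^sub>R b j)))" ..
    show ?thesis
      by (subst eq) (use mem Y in \<open>auto intro!: subspace_sum subspace_scale\<close>)
  qed
  then show ?thesis by (intro finite_subset[OF _ fin]) auto
qed

lemma family_card_le:
  fixes s :: "'i \<Rightarrow> 'v::real_vector"
  assumes "finite P" "finite G" "s ` P \<subseteq> span G"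
    and ind: "\<And>u. (\<Sum>p\<in>P. u p *\<^sub>R s p) = 0 \<Longrightarrow> \<forall>p\<in>P. u p = 0"
  shows "card P \<le> card G"
proof -
  have inj: "inj_on s P"
  proof (rule inj_onI, rule ccontr)
    fix p q assume pq: "p \<in> P" "q \<in> P" "s p = s q" "p \<noteq> q"
    have "(\<Sum>r\<in>P. ((if r = p then 1 else 0) - (if r = q then 1 else 0)) *\<^sub>R s r) = s p - s q"
      using pq assms(1) by (simp add: scaleR_left_diff_distrib sum_subtractf if_distrib[of "\<lambda>x. x *\<^sub>R _"] cong: if_cong)
    from ind[OF this[unfolded pq(3) diff_self]] pq show False by (metis diff_zero zero_neq_one)
  qed
  have "independent (s ` P)"
    unfolding dependent_finite[OF finite_imageI[OF assms(1)]]
  proof (safe)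
    fix u x assume u: "(\<Sum>v\<in>s ` P. u v *\<^sub>R v) = 0" "x \<in> P" "u (s x) \<noteq> 0"
    have "(\<Sum>p\<in>P. u (s p) *\<^sub>R s p) = 0" using u(1) by (simp add: sum.reindex[OF inj])
    from ind[OF this] u show False by simp
  qed
  then have "card (s ` P) \<le> card G" using assms(2,3) independent_span_bound by blast
  then show ?thesis using card_image[OF inj] by simp
qed

lemma ideal_plus_subspace:
  assumes "subspace A" "subspace Z"
  shows "subspace {x. \<exists>w \<in> Z. x - w \<in> (A :: 'v::real_vector set)}"
  unfolding subspace_def
proof (intro conjI ballI allI)
  show "0 \<in> {x. \<exists>w \<in> Z. x - w \<in> A}" using assms by (auto intro!: bexI[of _ 0] simp: subspace_0)
next
  fix x y assume "x \<in> {x. \<exists>w \<in> Z. x - w \<in> A}" "y \<in> {x. \<exists>w \<in> Z. x - w \<in> A}"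
  then obtain v w where "v \<in> Z" "w \<in> Z" "x - v \<in> A" "y - w \<in> A" by blast
  then show "x + y \<in> {x. \<exists>w \<in> Z. x - w \<in> A}"
    using subspace_add[OF assms(1), of "x - v" "y - w"] subspace_add[OF assms(2), of v w]
    by (auto intro!: bexI[of _ "v + w"] simp: add_diff_add)
next
  fix c x assume "x \<in> {x. \<exists>w \<in> Z. x - w \<in> A}"
  then obtain v where "v \<in> Z" "x - v \<in> A" by blast
  then show "c *\<^sub>R x \<in> {x. \<exists>w \<in> Z. x - w \<in> A}"
    using subspace_scale[OF assms(1), of "x - v" c] subspace_scale[OF assms(2), of v c]
    by (auto intro!: bexI[of _ "c *\<^sub>R v"] simp: scaleR_diff_right)
qed

lemma span_image_mult:
  fixes C :: "'r::{comm_ring_1,real_algebra_1} set"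
  assumes "v \<in> span C"
  shows "a * v \<in> span ((*) a ` C)"
  using assms
proof (induction rule: span_induct_alt)
  case base show ?case by (simp add: span_zero)
next
  case (step c x y)
  then show ?case by (auto simp: distrib_left intro!: span_add span_scale intro: span_base)
qed

lemma span_mult_span:
  fixes A B :: "'r::{comm_ring_1,real_algebra_1} set"
  assumes "f \<in> span A" "g \<in> span B"
  shows "f * g \<in> span {a * b |a b. a \<in> A \<and> b \<in> B}"
  using assms(1)
proof (induction rule: span_induct_alt)
  case base show ?case by (simp add: span_zero)
next
  case (step c x y)
  have "x * g \<in> span {a * b |a b. a \<in> A \<and> b \<in> B}"
    using span_image_mult[OF assms(2), of x] step(1)
      span_mono[of "(*) x ` B" "{a * b |a b. a \<in> A \<and> b \<in> B}"] by auto
  then show ?case using step by (auto simp: distrib_right intro!: span_add span_scale)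
qed

subsection \<open>Graded rings of odd degree\<close>

text \<open>By \<open>choose_mult\<close>, the square of \<open>(j + m) choose m\<close> is
  \<open>2 * e\<close> times \<open>(j + 2 * m) choose (2 * m)\<close> up to a factor tending to 1,
  while the term with \<open>K\<close> has lower order in \<open>j\<close>. A leading coefficient
  \<open>c < e\<close> is therefore too small in the long run.\<close>

lemma binomial_growth:
  fixes m e :: nat and K :: real
  assumes "m \<ge> 1" "2 * e = (2 * m) choose m" "c < e"
  shows "\<exists>j. real ((j + m) choose m) ^ 2 >
     2 * (K * real ((j + 2 * m - 1) choose (2 * m - 1)) + real c * real ((j + 2 * m) choose (2 * m)))"
proof -
  have lim: "(\<lambda>j. real ((j + m) choose m) / real ((j + 2 * m) choose m)) \<longlonglongrightarrow> 1"
  proof -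
    have eq: "real ((j + m) choose m) / real ((j + 2 * m) choose m) =
        (\<Prod>i\<in>{0..<m}. (real j + (real m - real i)) / (real j + (2 * real m - real i)))" for j
    proof -
      have "real ((j + m) choose m) = (\<Prod>i\<in>{0..<m}. real (j + m - i) / real (m - i))"
        by (rule binomial_altdef_of_nat) simp
      moreover have "real ((j + 2 * m) choose m) = (\<Prod>i\<in>{0..<m}. real (j + 2 * m - i) / real (m - i))"
        by (rule binomial_altdef_of_nat) simp
      ultimately have "real ((j + m) choose m) / real ((j + 2 * m) choose m) =
         (\<Prod>i\<in>{0..<m}. (real (j + m - i) / real (m - i)) / (real (j + 2 * m - i) / real (m - i)))"
        by (simp add: prod_dividef)
      also have "\<dots> = (\<Prod>i\<in>{0..<m}. (real j + (real m - real i)) / (real j + (2 * real m - real i)))"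
      proof (intro prod.cong refl)
        fix i assume "i \<in> {0..<m}"
        then have i: "i < m" by simp
        then have "real (j + m - i) / real (m - i) / (real (j + 2 * m - i) / real (m - i)) =
            real (j + m - i) / real (j + 2 * m - i)" by simp
        also have "\<dots> = (real j + (real m - real i)) / (real j + (2 * real m - real i))"
          using i by (simp add: of_nat_diff add_diff_eq)
        finally show "real (j + m - i) / real (m - i) / (real (j + 2 * m - i) / real (m - i)) =
            (real j + (real m - real i)) / (real j + (2 * real m - real i))" .
      qed
      finally show ?thesis .
    qed
    have "(\<lambda>j. (real j + a) / (real j + b)) \<longlonglongrightarrow> 1" for a b
      by real_asymp
    then have "(\<lambda>j. \<Prod>i\<in>{0..<m}. (real j + (real m - real i)) / (real j + (2 * real m - real i)))
        \<longlonglongrightarrow> (\<Prod>i\<in>{0..<m}. 1)"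
      by (intro tendsto_prod)
    then show ?thesis by (simp add: eq)
  qed
  \<comment> \<open>The difference of the two sides divided by
    \<open>(j + 2 * m) choose (2 * m)\<close>; its limit is \<open>2 * e - 2 * c\<close>.\<close>
  define F where "F = (\<lambda>j. 2 * real e * (real ((j + m) choose m) / real ((j + 2 * m) choose m))
      - 2 * K * (2 * real m / (real j + 2 * real m)) - 2 * real c)"
  have "F \<longlonglongrightarrow> 2 * real e * 1 - 2 * K * 0 - 2 * real c"
    unfolding F_def by (intro tendsto_intros lim) real_asymp
  moreover have "2 * real e * 1 - 2 * K * 0 - 2 * real c > 0" using assms(3) by simp
  ultimately have "eventually (\<lambda>j. F j > 0) sequentially"
    by (rule order_tendstoD)
  then obtain j where j: "F j > 0" by (auto simp: eventually_at_top_linorder)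
  define X where "X = real ((j + 2 * m) choose (2 * m))"
  have X: "X > 0" by (simp add: X_def)
  have "((j + 2 * m) choose (2 * m)) * ((2 * m) choose m) = ((j + 2 * m) choose m) * ((j + 2 * m - m) choose (2 * m - m))"
    by (rule choose_mult) auto
  then have "X * (2 * real e) = real ((j + 2 * m) choose m) * real ((j + m) choose m)"
    unfolding X_def assms(2)[symmetric] by (metis (no_types, lifting) add_diff_cancel_right' diff_add_inverse2 mult_2 of_nat_mult of_nat_numeral add.assoc)
  then have 1: "X * (2 * real e * (real ((j + m) choose m) / real ((j + 2 * m) choose m))) = real ((j + m) choose m) ^ 2"
    by (simp add: field_simps power2_eq_square)
  have "(j + 2 * m) * ((j + 2 * m - 1) choose (2 * m - 1)) = ((j + 2 * m) choose (2 * m)) * (2 * m)"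
    using Suc_times_binomial_eq[of "j + 2 * m - 1" "2 * m - 1"] assms(1) by simp
  then have "(real j + 2 * real m) * real ((j + 2 * m - 1) choose (2 * m - 1)) = X * (2 * real m)"
    unfolding X_def by (metis of_nat_add of_nat_mult of_nat_numeral)
  then have 2: "real ((j + 2 * m - 1) choose (2 * m - 1)) = X * (2 * real m / (real j + 2 * real m))"
    using assms(1) by (simp add: field_simps)
  have "X * F j > 0" using X j by simp
  then have "real ((j + m) choose m) ^ 2 > 2 * (K * real ((j + 2 * m - 1) choose (2 * m - 1)) + real c * X)"
    unfolding 2 1[symmetric] F_def by (simp add: algebra_simps)
  then show ?thesis unfolding X_def by blast
qed

lemma sum_list_update_Suc:
  "j < length \<gamma> \<Longrightarrow> sum_list (\<gamma>[j := Suc (\<gamma> ! j)]) = Suc (sum_list \<gamma>)"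
  by (induction \<gamma> arbitrary: j) (auto split: nat.splits simp: nth_Cons)

text \<open>Exponent vectors of the monomials of degree \<open>j\<close> in \<open>L\<close>
  variables.\<close>

definition words :: "nat \<Rightarrow> nat \<Rightarrow> nat list set" where
  "words L j = {\<gamma>. length \<gamma> = L \<and> sum_list \<gamma> = j}"

lemma card_words: "card (words L j) = (j + L - 1) choose j"
  unfolding words_def by (rule card_length_sum_list)

lemma finite_words: "finite (words L j)"
proof (rule finite_subset)
  show "words L j \<subseteq> {\<gamma>. set \<gamma> \<subseteq> {..j} \<and> length \<gamma> = L}"
    using member_le_sum_list by (auto simp: words_def)
qed (simp add: finite_lists_length_eq)

text \<open>In the applications \<open>B\<close> is the system to be solved and \<open>l\<close> plays the role of the hyperplane
  at infinity.\<close>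

locale graded_system =
  fixes S :: "nat \<Rightarrow> 'r::{comm_ring_1,real_algebra_1} set"
    and N d :: nat and B :: "nat \<Rightarrow> 'r" and l :: 'r
  assumes S_subspace: "subspace (S n)"
    and S_mult: "f \<in> S a \<Longrightarrow> g \<in> S b \<Longrightarrow> f * g \<in> S (a + b)"
    and S_gen: "n \<ge> 1 \<Longrightarrow> S (Suc n) \<subseteq> span {s * f |s f. s \<in> S 1 \<and> f \<in> S n}"
    and S_fin: "\<exists>G. finite G \<and> S n \<subseteq> span G"
    and B_S: "i < N \<Longrightarrow> B i \<in> S 1"
    and l_S: "l \<in> S 1"
    and d: "d \<ge> 1"
begin

text \<open>The degree \<open>n\<close> part of the ideal generated by the \<open>B i\<close>.
  Truncated subtraction makes \<open>I 0\<close> equal to \<open>I 1\<close>, which is why the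
  multiplicative laws ask for a positive degree.\<close>

definition I :: "nat \<Rightarrow> 'r set" where
  "I n = {\<Sum>i<N. B i * g i |g. \<forall>i<N. g i \<in> S (n - 1)}"

lemma I_memI: "(\<And>i. i < N \<Longrightarrow> g i \<in> S (n - 1)) \<Longrightarrow> (\<Sum>i<N. B i * g i) \<in> I n"
  by (auto simp: I_def)

lemma I_subspace: "subspace (I n)"
  unfolding subspace_def
proof (intro conjI ballI allI)
  show "0 \<in> I n" using I_memI[of "\<lambda>_. 0" n] S_subspace by (simp add: subspace_0)
next
  fix x y assume "x \<in> I n" "y \<in> I n"
  then obtain g h where "\<forall>i<N. g i \<in> S (n - 1)" "x = (\<Sum>i<N. B i * g i)"
    "\<forall>i<N. h i \<in> S (n - 1)" "y = (\<Sum>i<N. B i * h i)" by (auto simp: I_def)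
  then show "x + y \<in> I n"
    using I_memI[of "\<lambda>i. g i + h i" n] S_subspace[of "n - 1"]
    by (simp add: subspace_add distrib_left sum.distrib)
next
  fix c x assume "x \<in> I n"
  then obtain g where "\<forall>i<N. g i \<in> S (n - 1)" "x = (\<Sum>i<N. B i * g i)" by (auto simp: I_def)
  then show "c *\<^sub>R x \<in> I n"
    using I_memI[of "\<lambda>i. c *\<^sub>R g i" n] S_subspace[of "n - 1"]
    by (simp add: subspace_scale scaleR_sum_right)
qed

lemma I_mult: "f \<in> S a \<Longrightarrow> g \<in> I n \<Longrightarrow> n \<ge> 1 \<Longrightarrow> f * g \<in> I (a + n)"
proof -
  assume f: "f \<in> S a" and n: "n \<ge> 1" and "g \<in> I n"
  then obtain h where h: "\<And>i. i < N \<Longrightarrow> h i \<in> S (n - 1)" "g = (\<Sum>i<N. B i * h i)" by (auto simp: I_def)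
  have "(\<Sum>i<N. B i * (f * h i)) \<in> I (a + n)"
    using S_mult[OF f h(1)] n by (intro I_memI) simp
  then show "f * g \<in> I (a + n)"
    by (simp add: h(2) sum_distrib_left mult.left_commute)
qed

text \<open>Geometrically, the system has no solution at infinity: adding \<open>l\<close> to the
  ideal leaves nothing in degree \<open>Suc d\<close>.\<close>

definition S_top :: bool where
  "S_top \<longleftrightarrow> S (Suc d) \<subseteq> {f + l * g |f g. f \<in> I (Suc d) \<and> g \<in> S d}"

text \<open>Since \<open>S\<close> is generated in degree one, surjectivity of \<open>l\<close>
  propagates upwards: if \<open>f\<close> is congruent to \<open>l * h\<close>, then
  \<open>s * f\<close> is congruent to \<open>l * (s * h)\<close>.\<close>

lemma S_top_step:
  assumes S_top "n \<ge> d" "x \<in> S (Suc n)"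
  shows "\<exists>g \<in> S n. x - l * g \<in> I (Suc n)"
  using assms(2,3)
proof (induction arbitrary: x rule: dec_induct)
  case base
  then obtain f g where "x = f + l * g" "f \<in> I (Suc d)" "g \<in> S d"
    using assms(1) by (auto simp: S_top_def)
  then show ?case by (intro bexI[of _ g]) auto
next
  case (step n)
  have mem: "x \<in> span {s * f |s f. s \<in> S 1 \<and> f \<in> S (Suc n)}"
    using S_gen[of "Suc n"] step.prems by auto
  note IH = step.IH
  from mem show ?case
  proof (induction rule: span_induct_alt)
    case base
    show ?case by (rule bexI[of _ 0]) (use I_subspace S_subspace in \<open>auto simp: subspace_0\<close>)
  next
    case (step c b y)
    then obtain s f where sf: "s \<in> S 1" "f \<in> S (Suc n)" "b = s * f" by auto
    obtain h where h: "h \<in> S n" "f - l * h \<in> I (Suc n)" using IH[OF sf(2)] by blast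
    obtain g where g: "g \<in> S (Suc n)" "y - l * g \<in> I (Suc (Suc n))" using step by blast
    have "s * (f - l * h) \<in> I (Suc (Suc n))" using I_mult[OF sf(1) h(2)] by simp
    then have "c *\<^sub>R (s * (f - l * h)) + (y - l * g) \<in> I (Suc (Suc n))"
      using g I_subspace by (auto intro: subspace_add subspace_scale)
    also have "c *\<^sub>R (s * (f - l * h)) + (y - l * g) = c *\<^sub>R b + y - l * (c *\<^sub>R (s * h) + g)"
      by (simp add: sf algebra_simps)
    finally show ?case
      using S_mult[OF sf(1) h(1)] g(1) S_subspace
      by (intro bexI[of _ "c *\<^sub>R (s * h) + g"]) (auto intro: subspace_add subspace_scale)
  qed
qed

lemma l_pow_I: "a \<ge> 1 \<Longrightarrow> f \<in> I a \<Longrightarrow> l ^ k * f \<in> I (k + a)"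
proof (induction k)
  case (Suc k)
  then show ?case using I_mult[OF l_S, of "l ^ k * f" "k + a"] by (simp add: mult.assoc)
qed simp

text \<open>Iterating \<open>S_top_step\<close> reduces every higher degree to degree
  \<open>n0\<close>, so the dimension of the quotient no longer grows from there on.\<close>

lemma generated_above:
  assumes S_top "n0 \<ge> d" "\<And>x. x \<in> S n0 \<Longrightarrow> \<exists>w \<in> span C. x - w \<in> I n0"
    and "x \<in> S (k + n0)"
  shows "\<exists>w \<in> span C. x - l ^ k * w \<in> I (k + n0)"
  using assms(4)
proof (induction k arbitrary: x)
  case 0
  then show ?case using assms(3) by simp
next
  case (Suc k)
  obtain g where g: "g \<in> S (k + n0)" "x - l * g \<in> I (Suc (k + n0))"
    using S_top_step[OF assms(1), of "k + n0" x] assms(2) Suc.prems by auto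
  obtain w where w: "w \<in> span C" "g - l ^ k * w \<in> I (k + n0)" using Suc.IH[OF g(1)] by blast
  have "l * (g - l ^ k * w) \<in> I (Suc (k + n0))"
    using I_mult[OF l_S w(2)] assms(2) d by simp
  then have "(x - l * g) + l * (g - l ^ k * w) \<in> I (Suc (k + n0))"
    using g(2) subspace_add[OF I_subspace] by blast
  then show ?case using w(1) by (intro bexI[of _ w]) (simp_all add: algebra_simps)
qed

section \<open>Upper bound for the Hilbert function\<close>

definition mon :: "nat list \<Rightarrow> 'r" where
  "mon \<gamma> = (\<Prod>i<N. B i ^ (\<gamma> ! i))"

lemma mon_step:
  assumes "j < N" "length \<gamma> = N"
  shows "B j * mon \<gamma> = mon (\<gamma>[j := Suc (\<gamma> ! j)])"
proof -
  have "mon (\<gamma>[j := Suc (\<gamma> ! j)]) = (\<Prod>i<N. (if i = j then B i else 1) * B i ^ (\<gamma> ! i))"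
    unfolding mon_def by (intro prod.cong) (auto simp: assms nth_list_update)
  also have "\<dots> = B j * mon \<gamma>"
    using assms by (simp add: prod.distrib mon_def)
  finally show ?thesis ..
qed

text \<open>Writing an element as \<open>l ^ j * w\<close> plus a combination of the
  \<open>B i\<close>, and repeating this with the coefficients, ends in two kinds of products:
  monomials in the \<open>B i\<close> times a generator of degree \<open>n0\<close>, and monomials
  in \<open>l\<close> and the \<open>B i\<close> times an element of \<open>C\<close>. The head of
  the longer word is the exponent of \<open>l\<close>.\<close>

definition gens :: "'r set \<Rightarrow> 'r set \<Rightarrow> nat \<Rightarrow> 'r set" where
  "gens G C j = (\<lambda>(\<gamma>, g). mon \<gamma> * g) ` (words N j \<times> G) \<union>
     (\<lambda>(\<gamma>, g). mon (tl \<gamma>) * l ^ hd \<gamma> * g) ` (words (Suc N) j \<times> C)"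

lemma gens_step:
  assumes "x \<in> gens G C j" "i < N"
  shows "B i * x \<in> gens G C (Suc j)"
  using assms(1) unfolding gens_def
proof
  assume "x \<in> (\<lambda>(\<gamma>, g). mon \<gamma> * g) ` (words N j \<times> G)"
  then obtain \<gamma> g where g: "length \<gamma> = N" "sum_list \<gamma> = j" "g \<in> G" "x = mon \<gamma> * g"
    by (auto simp: words_def)
  define \<gamma>' where "\<gamma>' = \<gamma>[i := Suc (\<gamma> ! i)]"
  have "B i * x = mon \<gamma>' * g"
    using mon_step[OF assms(2) g(1)] by (simp add: g \<gamma>'_def mult.assoc[symmetric])
  moreover have "\<gamma>' \<in> words N (Suc j)"
    using g assms sum_list_update_Suc[of i \<gamma>] by (simp add: words_def \<gamma>'_def)
  ultimately show "B i * x \<in> (\<lambda>(\<gamma>, g). mon \<gamma> * g) ` (words N (Suc j) \<times> G) \<union>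
     (\<lambda>(\<gamma>, g). mon (tl \<gamma>) * l ^ hd \<gamma> * g) ` (words (Suc N) (Suc j) \<times> C)"
    using g(3) by force
next
  assume "x \<in> (\<lambda>(\<gamma>, g). mon (tl \<gamma>) * l ^ hd \<gamma> * g) ` (words (Suc N) j \<times> C)"
  then obtain \<beta> g where g0: "length \<beta> = Suc N" "sum_list \<beta> = j" "g \<in> C" "x = mon (tl \<beta>) * l ^ hd \<beta> * g"
    by (auto simp: words_def)
  obtain a \<gamma> where ag: "\<beta> = a # \<gamma>" using g0(1) by (cases \<beta>) auto
  have g: "length \<gamma> = N" "a + sum_list \<gamma> = j" "g \<in> C" "x = mon \<gamma> * l ^ a * g"
    using g0 by (auto simp: ag)
  define \<gamma>' where "\<gamma>' = \<gamma>[i := Suc (\<gamma> ! i)]"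
  have "B i * x = mon (tl (a # \<gamma>')) * l ^ hd (a # \<gamma>') * g"
    using mon_step[OF assms(2) g(1)] by (simp add: g \<gamma>'_def mult.assoc[symmetric])
  moreover have "a # \<gamma>' \<in> words (Suc N) (Suc j)"
    using g assms sum_list_update_Suc[of i \<gamma>] by (simp add: words_def \<gamma>'_def)
  ultimately show "B i * x \<in> (\<lambda>(\<gamma>, g). mon \<gamma> * g) ` (words N (Suc j) \<times> G) \<union>
     (\<lambda>(\<gamma>, g). mon (tl \<gamma>) * l ^ hd \<gamma> * g) ` (words (Suc N) (Suc j) \<times> C)"
    using g(3) by force
qed

text \<open>The first kind of product involves one variable less than the second, so its number has
  lower order in \<open>j\<close> and only \<open>card C\<close> enters the leading term.\<close>

lemma card_gens:
  assumes "finite G" "finite C" "N \<ge> 1"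
  shows "finite (gens G C j)"
    and "card (gens G C j) \<le> card G * ((j + N - 1) choose (N - 1)) + card C * ((j + N) choose N)"
proof -
  show "finite (gens G C j)" using assms finite_words by (simp add: gens_def)
  have "card (gens G C j) \<le> card (words N j \<times> G) + card (words (Suc N) j \<times> C)"
    unfolding gens_def using assms finite_words
    by (intro order_trans[OF card_Un_le] add_mono card_image_le) auto
  also have "\<dots> = card G * ((j + N - 1) choose j) + card C * ((j + N) choose j)"
    by (simp add: card_cartesian_product card_words mult.commute)
  also have "(j + N - 1) choose j = (j + N - 1) choose (N - 1)"
    using binomial_symmetric[of j "j + N - 1"] assms(3) by simp
  also have "(j + N) choose j = (j + N) choose N"
    using binomial_symmetric[of j "j + N"] by simp
  finally show "card (gens G C j) \<le> card G * ((j + N - 1) choose (N - 1)) + card C * ((j + N) choose N)" .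
qed

lemma gens_span:
  assumes S_top "n0 \<ge> d" "\<And>x. x \<in> S n0 \<Longrightarrow> \<exists>w \<in> span C. x - w \<in> I n0"
    and "S n0 \<subseteq> span G"
  shows "S (j + n0) \<subseteq> span (gens G C j)"
proof (induction j)
  case 0
  have "mon (replicate N 0) = 1" by (simp add: mon_def)
  then have 1: "g = (case (replicate N 0, g) of (\<gamma>, g) \<Rightarrow> mon \<gamma> * g)" for g by simp
  have "g \<in> gens G C 0" if "g \<in> G" for g
    unfolding gens_def using 1[of g] that
    by (intro UnI1 image_eqI[where x = "(replicate N 0, g)"]) (auto simp: words_def sum_list_replicate)
  then show ?case using assms(4) span_mono[of G "gens G C 0"] by auto
next
  case (Suc j)
  show ?case
  proof
    fix x assume "x \<in> S (Suc j + n0)"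
    then obtain w where w: "w \<in> span C" "x - l ^ Suc j * w \<in> I (Suc j + n0)"
      using generated_above[OF assms(1-3), of x "Suc j"] by blast
    then obtain g where g: "\<And>i. i < N \<Longrightarrow> g i \<in> S (j + n0)" "x - l ^ Suc j * w = (\<Sum>i<N. B i * g i)"
      by (auto simp: I_def)
    have 1: "(\<Sum>i<N. B i * g i) \<in> span (gens G C (Suc j))"
    proof (rule span_sum)
      fix i assume i: "i \<in> {..<N}"
      then have "g i \<in> span (gens G C j)" using g(1)[of i] Suc by auto
      from span_image_mult[OF this, of "B i"] show "B i * g i \<in> span (gens G C (Suc j))"
        using gens_step[of _ G C j i] i span_mono[of "(*) (B i) ` gens G C j" "gens G C (Suc j)"] by auto
    qed
    have "(*) (l ^ Suc j) ` C \<subseteq> gens G C (Suc j)"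
    proof safe
      fix c assume c: "c \<in> C"
      have "l ^ Suc j * c = mon (tl (Suc j # replicate N 0)) * l ^ hd (Suc j # replicate N 0) * c"
        by (simp add: mon_def)
      moreover have "Suc j # replicate N 0 \<in> words (Suc N) (Suc j)"
        by (simp add: words_def sum_list_replicate)
      ultimately show "l ^ Suc j * c \<in> gens G C (Suc j)"
        using c unfolding gens_def by force
    qed
    then have "l ^ Suc j * w \<in> span (gens G C (Suc j))"
      using span_image_mult[OF w(1)] span_mono by blast
    then have "(\<Sum>i<N. B i * g i) + l ^ Suc j * w \<in> span (gens G C (Suc j))"
      using 1 by (rule span_add[rotated])
    then show "x \<in> span (gens G C (Suc j))" using g(2) by (metis diff_add_cancel)
  qed
qed

end

locale odd_graded_system = graded_system +
  fixes m e :: nat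
  assumes m: "m \<ge> 1" and N: "N = 2 * m" and e: "2 * e = (2 * m) choose m" and e_odd: "odd e"
    and S_large: "finite G \<Longrightarrow> S n \<subseteq> span G \<Longrightarrow> ((n + m) choose m) ^ 2 \<le> 2 * card G"
    and S_top: S_top
begin

text \<open>By \<open>gens_span\<close>, the Hilbert function of \<open>S\<close> grows at most like \<open>card C\<close> times that
  of a polynomial ring, while \<open>S_large\<close> makes it grow at least \<open>e\<close> times as fast.\<close>

lemma few_generators:
  assumes "n0 \<ge> d" "\<And>x. x \<in> S n0 \<Longrightarrow> \<exists>w \<in> span C. x - w \<in> I n0" "finite C"
  shows "card C \<ge> e"
proof (rule ccontr)
  assume "\<not> card C \<ge> e"
  then have c: "card C < e" by simp
  obtain G where G: "finite G" "S n0 \<subseteq> span G" using S_fin by blast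
  obtain j where j: "real ((j + m) choose m) ^ 2 >
     2 * (real (card G) * real ((j + 2 * m - 1) choose (2 * m - 1)) + real (card C) * real ((j + 2 * m) choose (2 * m)))"
    using binomial_growth[OF m e c] by blast
  have "((j + m) choose m) ^ 2 \<le> ((j + n0 + m) choose m) ^ 2"
    by (intro power_mono binomial_right_mono) auto
  also have "\<dots> \<le> 2 * card (gens G C j)"
    using card_gens[OF G(1) assms(3)] gens_span[OF S_top assms(1,2) G(2)] m N
    by (intro S_large) auto
  also have "\<dots> \<le> 2 * (card G * ((j + N - 1) choose (N - 1)) + card C * ((j + N) choose N))"
    using card_gens[OF G(1) assms(3)] m N by (intro mult_left_mono) auto
  finally have "real (((j + m) choose m) ^ 2) \<le> real (2 * (card G * ((j + N - 1) choose (N - 1)) + card C * ((j + N) choose N)))"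
    by (rule of_nat_mono)
  with j show False unfolding N by simp
qed

text \<open>From degree \<open>d\<close> on, the quotient is a copy of \<open>span C\<close> through
  multiplication by powers of \<open>l\<close>, and every \<open>s\<close> of degree one acts on it
  as \<open>s / l\<close>. For a common eigenvector \<open>q\<close>, the congruence of
  \<open>f * q\<close> and \<open>lam k f *\<^sub>R (l ^ k * q)\<close> defines a multiplicative
  \<open>lam\<close>: evaluation at a real solution, normalised by \<open>l = 1\<close>.\<close>

lemma graded_character:
  assumes C: "finite C" "card C \<le> e" "C \<subseteq> S d" "\<And>x. x \<in> S d \<Longrightarrow> \<exists>w \<in> span C. x - w \<in> I d"
  obtains lam :: "nat \<Rightarrow> 'a \<Rightarrow> real" where
    "\<And>k f g. k \<ge> 1 \<Longrightarrow> f \<in> S k \<Longrightarrow> g \<in> S k \<Longrightarrow> lam k (f + g) = lam k f + lam k g"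
    "\<And>k f c. k \<ge> 1 \<Longrightarrow> f \<in> S k \<Longrightarrow> lam k (c *\<^sub>R f) = c * lam k f"
    "\<And>j k f g. j \<ge> 1 \<Longrightarrow> k \<ge> 1 \<Longrightarrow> f \<in> S j \<Longrightarrow> g \<in> S k \<Longrightarrow> lam (j + k) (f * g) = lam j f * lam k g"
    "\<And>i. i < N \<Longrightarrow> lam 1 (B i) = 0"
    "lam 1 l = 1"
proof -
  have spC: "span C \<subseteq> S d" using C(3) S_subspace by (simp add: span_minimal)
  \<comment> \<open>A redundant element could be dropped, leaving fewer than \<open>e\<close>
    spanning elements, against \<open>few_generators\<close>.\<close>
  have indep: "independent C"
  proof
    assume "dependent C"
    then obtain c where c: "c \<in> C" "c \<in> span (C - {c})" by (auto simp: dependent_def)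
    then have "span C = span (C - {c})" using span_redundant[OF c(2)] by (simp add: insert_absorb)
    then have "card (C - {c}) \<ge> e" using C by (intro few_generators[of d]) auto
    moreover have "card (C - {c}) < card C" using C(1) c(1) by (rule card_Diff1_less)
    ultimately show False using C(2) by simp
  qed
  have card: "card C = e" using few_generators[of d C] C by simp
  \<comment> \<open>Multiplication by \<open>l ^ k\<close> is injective on \<open>span C\<close>
    modulo the ideal: a nonzero \<open>v\<close> in its kernel could replace the generator
    \<open>c\<close> and then be discarded, so that fewer than \<open>e\<close> elements would span
    in degree \<open>k + d\<close>.\<close>
  have inj: "v = 0" if v: "v \<in> span C" "l ^ k * v \<in> I (k + d)" for v k
  proof (rule ccontr)
    assume "v \<noteq> 0"
    obtain u where u: "v = (\<Sum>c\<in>C. u c *\<^sub>R c)" using span_finite[OF C(1)] v(1) by auto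
    then obtain c where c: "c \<in> C" "u c \<noteq> 0" using \<open>v \<noteq> 0\<close>
      by (force intro: sum.neutral)
    define C' where "C' = C - {c}"
    have "v - u c *\<^sub>R c = (\<Sum>c\<in>C'. u c *\<^sub>R c)"
      using c C(1) by (simp add: u C'_def sum_diff1)
    then have "v - u c *\<^sub>R c \<in> span C'" by (auto intro!: span_sum span_scale intro: span_base)
    have "\<exists>w' \<in> span C'. \<exists>a. w = w' + a *\<^sub>R v" if "w \<in> span C" for w
    proof -
      have "c = (1 / u c) *\<^sub>R v - (1 / u c) *\<^sub>R (v - u c *\<^sub>R c)"
        using c(2) by (simp add: algebra_simps)
      then have "c \<in> span (insert v C')"
        using \<open>v - u c *\<^sub>R c \<in> span C'\<close>
        by (metis (no_types, lifting) insertI1 span_base span_diff span_mono span_scale subset_insertI subsetD)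
      then have "C \<subseteq> span (insert v C')"
        by (auto simp: C'_def intro: span_base)
      then have "w \<in> span (insert v C')" using that by (metis span_minimal subsetD subspace_span)
      then obtain a where "w - a *\<^sub>R v \<in> span C'" by (auto simp: span_insert)
      then show ?thesis by (intro bexI[of _ "w - a *\<^sub>R v"] exI[of _ a]) auto
    qed
    note dec = this
    have "card ((*) (l ^ k) ` C') \<ge> e"
    proof (rule few_generators[of "k + d"])
      fix x assume x: "x \<in> S (k + d)"
      obtain w where w: "w \<in> span C" "x - l ^ k * w \<in> I (k + d)"
        using generated_above[OF S_top order_refl C(4) x] by blast
      obtain w' a where w': "w' \<in> span C'" "w = w' + a *\<^sub>R v" using dec[OF w(1)] by blast
      have "(x - l ^ k * w) + a *\<^sub>R (l ^ k * v) \<in> I (k + d)"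
        using w(2) v(2) I_subspace by (auto intro: subspace_add subspace_scale)
      then show "\<exists>w\<in>span ((*) (l ^ k) ` C'). x - w \<in> I (k + d)"
        using span_image_mult[OF w'(1), of "l ^ k"]
        by (intro bexI[of _ "l ^ k * w'"]) (auto simp: w'(2) algebra_simps)
    qed (use C(1) C'_def in auto)
    moreover have "card ((*) (l ^ k) ` C') \<le> card C'" using C(1) by (simp add: C'_def card_image_le)
    moreover have "card C' < card C" unfolding C'_def using C(1) c(1) by (rule card_Diff1_less)
    ultimately show False using C(2) by simp
  qed
  \<comment> \<open>\<open>T\<close> is multiplication by \<open>s\<close> followed by division by
    \<open>l\<close>, chosen on the basis \<open>C\<close> and extended linearly.\<close>
  have exT: "\<exists>T. linear T \<and> T ` span C \<subseteq> span C \<and> (s \<in> S 1 \<longrightarrow> (\<forall>v \<in> span C. s * v - l * T v \<in> I (Suc d)))" for s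
  proof (cases "s \<in> S 1")
    case True
    have "\<exists>w \<in> span C. s * c - l * w \<in> I (Suc d)" if "c \<in> C" for c
      using generated_above[OF S_top order_refl C(4), of "s * c" 1] S_mult[OF True, of c d] C(3) that
      by auto
    then obtain w where w: "\<And>c. c \<in> C \<Longrightarrow> w c \<in> span C" "\<And>c. c \<in> C \<Longrightarrow> s * c - l * w c \<in> I (Suc d)"
      by metis
    obtain T where T: "linear T" "\<forall>c\<in>C. T c = w c"
      using linear_independent_extend[OF indep] by blast
    have "T v \<in> span C \<and> s * v - l * T v \<in> I (Suc d)" if "v \<in> span C" for v
      using that
    proof (induction rule: span_induct_alt)
      case base
      then show ?case using linear_0[OF T(1)] I_subspace by (simp add: span_zero subspace_0)
    next
      case (step a x y)
      have "a *\<^sub>R (s * x - l * T x) + (s * y - l * T y) \<in> I (Suc d)"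
        by (intro subspace_add[OF I_subspace] subspace_scale[OF I_subspace]) (use step w T(2) in auto)
      also have "a *\<^sub>R (s * x - l * T x) + (s * y - l * T y) = s * (a *\<^sub>R x + y) - l * T (a *\<^sub>R x + y)"
        by (simp add: linear_add[OF T(1)] linear_scale[OF T(1)] algebra_simps)
      finally show ?case using step w(1) T(2)
        by (auto simp: linear_add[OF T(1)] linear_scale[OF T(1)] intro: span_add span_scale)
    qed
    then show ?thesis using T(1) by blast
  next
    case False
    then show ?thesis by (intro exI[of _ "\<lambda>_. 0"]) (auto simp: span_zero linear_zero)
  qed
  \<comment> \<open>Every ring element gets an operator, zero outside degree one, because
    \<open>common_eigenvector\<close> ranges over a whole index type.\<close>
  define T where "T = (\<lambda>s. if s \<in> S 1 then SOME T. linear T \<and> T ` span C \<subseteq> span C \<and>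
      (s \<in> S 1 \<longrightarrow> (\<forall>v \<in> span C. s * v - l * T v \<in> I (Suc d))) else (\<lambda>_. 0))"
  have T: "linear (T s)" "T s ` span C \<subseteq> span C" for s
    using someI_ex[OF exT[of s]] by (auto simp: T_def span_zero linear_zero)
  have TI: "s * v - l * T s v \<in> I (Suc d)" if "s \<in> S 1" "v \<in> span C" for s v
    using someI_ex[OF exT[of s]] that by (auto simp: T_def)
  \<comment> \<open>Both orders of composition represent \<open>s * s'\<close> divided by
    \<open>l ^ 2\<close>; together with \<open>inj\<close> this makes the operators commute.\<close>
  have TT: "s * (s' * v) - l ^ 2 * T s (T s' v) \<in> I (2 + d)" if "s \<in> S 1" "s' \<in> S 1" "v \<in> span C" for s s' v
  proof -
    have v': "T s' v \<in> span C" using T(2) that(3) by blast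
    have "s * (s' * v - l * T s' v) + l * (s * T s' v - l * T s (T s' v)) \<in> I (1 + Suc d)"
      using I_mult[OF that(1) TI[OF that(2,3)]] I_mult[OF l_S TI[OF that(1) v']] I_subspace
      by (auto intro: subspace_add)
    then show ?thesis by (simp add: algebra_simps power2_eq_square)
  qed
  have "\<exists>q \<in> span C. q \<noteq> 0 \<and> (\<forall>s. \<exists>c. T s q = c *\<^sub>R q)"
  proof (rule common_eigenvector[OF T(1) C(1) indep _ T(2)])
    show "odd (card C)" using card e_odd by simp
    fix s s' v assume v: "v \<in> span C"
    show "T s (T s' v) = T s' (T s v)"
    proof (cases "s \<in> S 1 \<and> s' \<in> S 1")
      case True
      then have "(s' * (s * v) - l ^ 2 * T s' (T s v)) - (s * (s' * v) - l ^ 2 * T s (T s' v)) \<in> I (2 + d)"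
        using TT[of s s' v] TT[of s' s v] v subspace_diff[OF I_subspace] by blast
      then have "l ^ 2 * (T s (T s' v) - T s' (T s v)) \<in> I (2 + d)"
        by (simp add: algebra_simps)
      moreover have "T s (T s' v) - T s' (T s v) \<in> span C"
        using v T(2) by (intro span_diff) blast+
      ultimately have "T s (T s' v) - T s' (T s v) = 0" using inj by blast
      then show ?thesis by simp
    next
      case False
      moreover have "T r u = 0" if "r \<notin> S 1" for r u using that by (simp add: T_def)
      ultimately show ?thesis using linear_0[OF T(1)] by metis
    qed
  qed
  then obtain q where q: "q \<in> span C" "q \<noteq> 0" "\<And>s. \<exists>c. T s q = c *\<^sub>R q" by blast
  \<comment> \<open>\<open>E k f c\<close> says that \<open>f\<close> acts on \<open>q\<close> as
    \<open>c\<close> times \<open>l ^ k\<close>. It is a relation at first; \<open>q0\<close> makes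
    \<open>c\<close> unique, and generation in degree one makes it exist.\<close>
  define E where "E = (\<lambda>k f c. f * q - c *\<^sub>R (l ^ k * q) \<in> I (k + d))"
  have q0: "l ^ k * q \<notin> I (k + d)" for k using inj q(1,2) by blast
  have E_unique: "c = c'" if "E k f c" "E k f c'" for k f c c'
  proof (rule ccontr)
    assume "c \<noteq> c'"
    have "(f * q - c' *\<^sub>R (l ^ k * q)) - (f * q - c *\<^sub>R (l ^ k * q)) \<in> I (k + d)"
      using that subspace_diff[OF I_subspace] unfolding E_def by blast
    then have "(c - c') *\<^sub>R (l ^ k * q) \<in> I (k + d)"
      by (simp add: algebra_simps)
    then have "(1 / (c - c')) *\<^sub>R ((c - c') *\<^sub>R (l ^ k * q)) \<in> I (k + d)"
      by (rule subspace_scale[OF I_subspace])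
    then show False using q0 \<open>c \<noteq> c'\<close> by simp
  qed
  have E_add: "E k (f + g) (a + b)" if "E k f a" "E k g b" for k f g a b
  proof -
    have "(f * q - a *\<^sub>R (l ^ k * q)) + (g * q - b *\<^sub>R (l ^ k * q)) \<in> I (k + d)"
      using that subspace_add[OF I_subspace] unfolding E_def by blast
    then show ?thesis by (simp add: E_def algebra_simps)
  qed
  have E_scale: "E k (c *\<^sub>R f) (c * a)" if "E k f a" for k f c a
  proof -
    have "c *\<^sub>R (f * q - a *\<^sub>R (l ^ k * q)) \<in> I (k + d)"
      using that subspace_scale[OF I_subspace] unfolding E_def by blast
    then show ?thesis by (simp add: E_def algebra_simps)
  qed
  have E_mult: "E (j + k) (f * g) (a * b)" if "E j f a" "E k g b" "f \<in> S j" for j k f g a b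
  proof -
    have "f * (g * q - b *\<^sub>R (l ^ k * q)) \<in> I (j + (k + d))"
      using that d unfolding E_def by (intro I_mult) auto
    moreover have "l ^ k * (f * q - a *\<^sub>R (l ^ j * q)) \<in> I (k + (j + d))"
      using that d unfolding E_def by (intro l_pow_I) auto
    ultimately have "f * (g * q - b *\<^sub>R (l ^ k * q)) + b *\<^sub>R (l ^ k * (f * q - a *\<^sub>R (l ^ j * q))) \<in> I (j + k + d)"
      using I_subspace by (auto intro!: subspace_add subspace_scale simp: add_ac)
    then show ?thesis by (simp add: E_def algebra_simps power_add)
  qed
  have E1: "\<exists>c. E 1 s c" if "s \<in> S 1" for s
  proof -
    obtain c where "T s q = c *\<^sub>R q" using q(3) by blast
    then show ?thesis using TI[OF that q(1)] by (intro exI[of _ c]) (simp add: E_def)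
  qed
  have E_ex: "\<exists>c. E k f c" if "k \<ge> 1" "f \<in> S k" for k f
    using that
  proof (induction arbitrary: f rule: dec_induct)
    case base
    then show ?case using E1 by simp
  next
    case (step k)
    have "f \<in> span {s * f |s f. s \<in> S 1 \<and> f \<in> S k}" using S_gen[of k] step by auto
    note IH = step.IH
    from \<open>f \<in> span _\<close> show ?case
    proof (induction rule: span_induct_alt)
      case base
      show ?case using I_subspace by (intro exI[of _ 0]) (simp add: E_def subspace_0)
    next
      case (step c x y)
      then obtain s g where sg: "s \<in> S 1" "g \<in> S k" "x = s * g" by auto
      obtain a where "E 1 s a" using E1 sg by blast
      moreover obtain b where "E k g b" using IH sg by blast
      ultimately have "E (Suc k) x (a * b)" using E_mult[of 1 s a k g b] sg by simp
      moreover obtain b' where "E (Suc k) y b'" using step by blast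
      ultimately show ?case using E_add E_scale by blast
    qed
  qed
  define lam where "lam = (\<lambda>k f. THE c. E k f c)"
  have lam: "lam k f = c" if "E k f c" for k f c
    unfolding lam_def using that E_unique by blast
  have Elam: "E k f (lam k f)" if "k \<ge> 1" "f \<in> S k" for k f
    using E_ex[OF that] lam by auto
  show thesis
  proof
    fix k f g assume "k \<ge> 1" "f \<in> S k" "g \<in> S k"
    then show "lam k (f + g) = lam k f + lam k g" by (intro lam E_add Elam)
  next
    fix k f c assume "k \<ge> 1" "f \<in> S k"
    then show "lam k (c *\<^sub>R f) = c * lam k f" by (intro lam E_scale Elam)
  next
    fix j k f g assume "j \<ge> 1" "k \<ge> 1" "f \<in> S j" "g \<in> S k"
    then show "lam (j + k) (f * g) = lam j f * lam k g" by (intro lam E_mult Elam)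
  next
    fix i assume i: "i < N"
    have "(\<Sum>i'<N. B i' * (if i' = i then q else 0)) \<in> I (1 + d)"
      using q(1) spC S_subspace by (intro I_memI) (auto simp: subspace_0)
    also have "(\<Sum>i'<N. B i' * (if i' = i then q else 0)) = B i * q"
      using i by (simp add: if_distrib[of "\<lambda>x. _ * x"] cong: if_cong)
    finally show "lam 1 (B i) = 0" by (intro lam) (simp add: E_def)
  next
    show "lam 1 l = 1" using subspace_0[OF I_subspace] by (intro lam) (simp add: E_def)
  qed
qed

end

subsection \<open>Symmetric products of linear forms\<close>

lemma scaleR_fun_apply [simp]: "(c *\<^sub>R f) x = c *\<^sub>R f x"
  by (simp add: scaleR_fun_def)

lemma sum_fun_apply: "(\<Sum>i\<in>A. f i) x = (\<Sum>i\<in>A. f i x)"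
  by (induction A rule: infinite_finite_induct) auto

lemma power_sum_zero:
  fixes c :: "nat \<Rightarrow> real"
  assumes "finite A" "\<And>T. (\<Sum>a\<in>A. c a * T ^ a) = 0" "a \<in> A"
  shows "c a = 0"
proof -
  define p where "p = (\<Sum>a\<in>A. Polynomial.monom (c a) a)"
  have "poly p T = 0" for T using assms(2)[of T] by (simp add: p_def poly_sum poly_monom)
  then have "p = 0" using poly_all_0_iff_0 by blast
  then have "coeff p a = 0" by simp
  then show ?thesis using assms(1,3) by (simp add: p_def coeff_sum)
qed

lemma power_sum_zero2:
  fixes c :: "nat \<Rightarrow> nat \<Rightarrow> real"
  assumes "finite A" "\<And>T U. (\<Sum>a\<in>A. \<Sum>b\<in>A. c a b * (T ^ a * U ^ b)) = 0" "a \<in> A" "b \<in> A"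
  shows "c a b = 0"
proof (rule power_sum_zero[OF assms(1) _ assms(4)])
  fix U
  show "(\<Sum>b\<in>A. c a b * U ^ b) = 0"
    by (rule power_sum_zero[OF assms(1) _ assms(3), of "\<lambda>a. \<Sum>b\<in>A. c a b * U ^ b"])
      (use assms(2)[of _ U] in \<open>simp add: sum_distrib_left sum_distrib_right mult_ac\<close>)
qed

text \<open>Not normalised: \<open>sprod f f\<close> is twice the product, which explains the
  factors one half in \<open>H_eq\<close>, \<open>symmetric_bilinear_expand\<close> and
  \<open>character_matrix\<close>.\<close>

definition sprod :: "('a \<Rightarrow> real) \<Rightarrow> ('a \<Rightarrow> real) \<Rightarrow> 'a \<times> 'a \<Rightarrow> real" where
  "sprod f g = (\<lambda>(x, y). f x * g y + f y * g x)"

lemma sprod_commute: "sprod f g = sprod g f"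
  by (auto simp: sprod_def)

lemma sprod_add: "sprod (f + f') g = sprod f g + sprod f' g"
  by (auto simp: sprod_def algebra_simps)

lemma sprod_scale: "sprod (c *\<^sub>R f) g = c *\<^sub>R sprod f g"
  by (auto simp: sprod_def algebra_simps)

lemma sprod_zero: "sprod 0 g = 0"
  by (auto simp: sprod_def)

lemma sprod_mult: "sprod f g * sprod f' g' = sprod (f * f') (g * g') + sprod (f * g') (g * f')"
  by (auto simp: sprod_def algebra_simps)

lemma sprod_span:
  assumes "f \<in> span A" "g \<in> span B"
  shows "sprod f g \<in> span {sprod a b |a b. a \<in> A \<and> b \<in> B}"
proof -
  have 1: "sprod f b \<in> span {sprod a b |a b. a \<in> A \<and> b \<in> B}" if "b \<in> B" for b
    using assms(1)
  proof (induction rule: span_induct_alt)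
    case base show ?case unfolding sprod_zero by (rule span_zero)
  next
    case (step c x y)
    then show ?case using that
      unfolding sprod_add sprod_scale by (intro span_add span_scale) (auto intro: span_base)
  qed
  show ?thesis
    using assms(2)
  proof (induction rule: span_induct_alt)
    case base show ?case unfolding sprod_commute[of f 0] sprod_zero by (rule span_zero)
  next
    case (step c x y)
    then show ?case using 1
      unfolding sprod_commute[of f "_ + _"] sprod_add sprod_scale
      by (intro span_add span_scale) (auto simp: sprod_commute[of _ f])
  qed
qed

lemma digits_inj:
  fixes q :: nat
  assumes "length \<gamma> = length \<delta>" "\<forall>x\<in>set \<gamma>. x < q" "\<forall>x\<in>set \<delta>. x < q"
    "(\<Sum>i<length \<gamma>. \<gamma> ! i * q ^ i) = (\<Sum>i<length \<delta>. \<delta> ! i * q ^ i)"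
  shows "\<gamma> = \<delta>"
  using assms
proof (induction \<gamma> \<delta> rule: list_induct2)
  case (Cons x xs y ys)
  have *: "(\<Sum>i<length (z # zs). (z # zs) ! i * q ^ i) = z + q * (\<Sum>i<length zs. zs ! i * q ^ i)" for z zs
    by (simp add: sum.lessThan_Suc_shift sum_distrib_left mult_ac del: sum.lessThan_Suc)
  have eq: "x + q * (\<Sum>i<length xs. xs ! i * q ^ i) = y + q * (\<Sum>i<length ys. ys ! i * q ^ i)"
    using Cons.prems(3) unfolding * .
  have "x = y" using arg_cong[OF eq, of "\<lambda>n. n mod q"] Cons.prems by simp
  moreover have "(\<Sum>i<length xs. xs ! i * q ^ i) = (\<Sum>i<length ys. ys ! i * q ^ i)"
    using eq \<open>x = y\<close> Cons.prems by auto
  ultimately show ?case using Cons by simp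
qed simp

text \<open>\<open>2 * m + 1\<close> forms in general position in \<open>m + 1\<close> variables:
  the first \<open>2 * m\<close> make up the split system, the last one gives the hyperplane at
  infinity.\<close>

locale forms =
  fixes L :: "nat \<Rightarrow> 'a \<Rightarrow> real" and m :: nat
  assumes m: "m \<ge> 1"
    and L_span: "K \<subseteq> {..2 * m} \<Longrightarrow> card K = Suc m \<Longrightarrow> i \<le> 2 * m \<Longrightarrow> L i \<in> span (L ` K)"
    and L_coord: "\<exists>x. \<forall>i\<le>m. L i x = f i"
begin

section \<open>The graded ring of symmetric functions of equal bidegree\<close>

definition monomial :: "nat list \<Rightarrow> 'a \<Rightarrow> real" where
  "monomial w = prod_list (map L w)"

lemma monomial_simps [simp]: "monomial [] = 1" "monomial (i # w) = L i * monomial w" "monomial (u @ v) = monomial u * monomial v"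
  by (simp_all add: monomial_def)

lemma monomial_remove1: "j \<in> set w \<Longrightarrow> monomial w = L j * monomial (remove1 j w)"
  by (induction w) (auto simp: mult.left_commute)

definition W :: "nat set \<Rightarrow> nat \<Rightarrow> nat list set" where
  "W K n = {w. set w \<subseteq> K \<and> length w = n}"

lemma W_I: "set w \<subseteq> K \<Longrightarrow> length w = n \<Longrightarrow> w \<in> W K n"
  by (simp add: W_def)

lemma finite_W: "finite K \<Longrightarrow> finite (W K n)"
  unfolding W_def by (rule finite_lists_length_eq)

definition V :: "nat \<Rightarrow> ('a \<Rightarrow> real) set" where
  "V n = span (monomial ` W {..2 * m} n)"

text \<open>Functions of \<open>(x, y)\<close> that have degree \<open>n\<close> in each argument
  and are symmetric under exchange; together they form the coordinate ring of unordered pairs of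
  points.\<close>

definition S :: "nat \<Rightarrow> ('a \<times> 'a \<Rightarrow> real) set" where
  "S n = span {sprod a b |a b. a \<in> monomial ` W {..2 * m} n \<and> b \<in> monomial ` W {..2 * m} n}"

lemma V_subspace: "subspace (V n)" by (simp add: V_def)

lemma S_subspace: "subspace (S n)" by (simp add: S_def)

lemma monomial_V: "set w \<subseteq> {..2 * m} \<Longrightarrow> length w = n \<Longrightarrow> monomial w \<in> V n"
  unfolding V_def by (intro span_base imageI W_I)

lemma L_V: "i \<le> 2 * m \<Longrightarrow> L i \<in> V 1"
  using monomial_V[of "[i]" 1] by simp

lemma V_mult: "f \<in> V a \<Longrightarrow> g \<in> V b \<Longrightarrow> f * g \<in> V (a + b)"
proof -
  assume "f \<in> V a" "g \<in> V b"
  then have "f * g \<in> span {x * y |x y. x \<in> monomial ` W {..2 * m} a \<and> y \<in> monomial ` W {..2 * m} b}"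
    unfolding V_def by (rule span_mult_span)
  also have "\<dots> \<subseteq> V (a + b)"
  proof (rule span_minimal[OF _ V_subspace], safe)
    fix u v assume "u \<in> W {..2 * m} a" "v \<in> W {..2 * m} b"
    then show "monomial u * monomial v \<in> V (a + b)"
      using monomial_V[of "u @ v" "a + b"] by (auto simp: W_def)
  qed
  finally show ?thesis .
qed

lemma sprod_S: "f \<in> V n \<Longrightarrow> g \<in> V n \<Longrightarrow> sprod f g \<in> S n"
  unfolding V_def S_def by (rule sprod_span)

lemma S_mult: "f \<in> S a \<Longrightarrow> g \<in> S b \<Longrightarrow> f * g \<in> S (a + b)"
proof -
  let ?X = "\<lambda>n. {sprod a b |a b. a \<in> monomial ` W {..2 * m} n \<and> b \<in> monomial ` W {..2 * m} n}"
  assume "f \<in> S a" "g \<in> S b"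
  then have "f * g \<in> span {x * y |x y. x \<in> ?X a \<and> y \<in> ?X b}"
    unfolding S_def by (rule span_mult_span)
  also have "\<dots> \<subseteq> S (a + b)"
  proof (rule span_minimal[OF _ S_subspace], clarify)
    fix u u' v v' assume "u \<in> W {..2 * m} a" "u' \<in> W {..2 * m} a" "v \<in> W {..2 * m} b" "v' \<in> W {..2 * m} b"
    then have "monomial u \<in> V a" "monomial u' \<in> V a" "monomial v \<in> V b" "monomial v' \<in> V b"
      by (auto simp: W_def intro: monomial_V)
    then show "sprod (monomial u) (monomial u') * sprod (monomial v) (monomial v') \<in> S (a + b)"
      unfolding sprod_mult
      by (intro subspace_add[OF S_subspace] sprod_S V_mult) 
  qed
  finally show ?thesis .
qed

text \<open>Splitting \<open>sprod (L h) (L k)\<close> off the pair of words also produces a mixed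
  term, by \<open>sprod_mult\<close>. Two further products with rearranged letters cancel it and
  leave twice the desired element. This takes a second letter \<open>i\<close> of \<open>w\<close>,
  hence \<open>n \<ge> 1\<close>.\<close>

lemma S_gen:
  assumes "n \<ge> 1"
  shows "S (Suc n) \<subseteq> span {s * f |s f. s \<in> S 1 \<and> f \<in> S n}"
  unfolding S_def[of "Suc n"]
proof (rule span_minimal[OF _ subspace_span], clarify)
  fix w w' assume "w \<in> W {..2 * m} (Suc n)" "w' \<in> W {..2 * m} (Suc n)"
  then have ww: "set w \<subseteq> {..2 * m}" "length w = Suc n" "set w' \<subseteq> {..2 * m}" "length w' = Suc n"
    by (auto simp: W_def)
  obtain i h u where w: "w = i # h # u" using ww(2) assms
    by (metis Suc_length_conv Suc_le_D One_nat_def)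
  obtain j k v where w': "w' = j # k # v" using ww(4) assms
    by (metis Suc_length_conv Suc_le_D One_nat_def)
  let ?X = "{s * f |s f. s \<in> S 1 \<and> f \<in> S n}"
  have L: "L i \<in> V 1" "L j \<in> V 1" "L h \<in> V 1" "L k \<in> V 1"
    using ww by (auto simp: w w' intro!: L_V simp del: One_nat_def)
  have M: "L x * monomial u \<in> V n" "L x * monomial v \<in> V n" if "x \<le> 2 * m" for x
    using monomial_V[of "x # u" n] monomial_V[of "x # v" n] ww that by (auto simp: w w')
  have X: "x * y \<in> ?X" if "x \<in> S 1" "y \<in> S n" for x y using that by blast
  have b: "i \<le> 2 * m" "j \<le> 2 * m" "h \<le> 2 * m" "k \<le> 2 * m" using ww by (auto simp: w w')
  have 1: "sprod (L h) (L k) * sprod (L i * monomial u) (L j * monomial v) \<in> ?X"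
    "sprod (L i) (L k) * sprod (L h * monomial u) (L j * monomial v) \<in> ?X"
    "sprod (L i) (L h) * sprod (L k * monomial u) (L j * monomial v) \<in> ?X"
    using X[OF sprod_S[OF L(3,4)] sprod_S[OF M(1)[OF b(1)] M(2)[OF b(2)]]]
      X[OF sprod_S[OF L(1,4)] sprod_S[OF M(1)[OF b(3)] M(2)[OF b(2)]]]
      X[OF sprod_S[OF L(1,3)] sprod_S[OF M(1)[OF b(4)] M(2)[OF b(2)]]] by blast+
  have "sprod (L h) (L k) * sprod (L i * monomial u) (L j * monomial v)
      + sprod (L i) (L k) * sprod (L h * monomial u) (L j * monomial v)
      - sprod (L i) (L h) * sprod (L k * monomial u) (L j * monomial v) = 2 *\<^sub>R sprod (monomial w) (monomial w')"
    by (auto simp: w w' sprod_def fun_eq_iff algebra_simps)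
  then have "sprod (monomial w) (monomial w') = (1/2) *\<^sub>R (sprod (L h) (L k) * sprod (L i * monomial u) (L j * monomial v)
      + sprod (L i) (L k) * sprod (L h * monomial u) (L j * monomial v)
      - sprod (L i) (L h) * sprod (L k * monomial u) (L j * monomial v))" by simp
  also have "\<dots> \<in> span ?X"
    using 1 by (intro span_scale span_diff span_add) (auto intro: span_base)
  finally show "sprod (monomial w) (monomial w') \<in> span ?X" .
qed

lemma S_generators:
  "finite {sprod a b |a b. a \<in> monomial ` W {..2 * m} n \<and> b \<in> monomial ` W {..2 * m} n}"
proof -
  have "finite ((\<lambda>(a, b). sprod a b) ` ((monomial ` W {..2 * m} n) \<times> (monomial ` W {..2 * m} n)))"
    by (intro finite_imageI finite_cartesian_product finite_W) auto
  then show ?thesis by (rule finite_subset[rotated]) auto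
qed

section \<open>Lower bound for the Hilbert function\<close>

definition emon :: "nat list \<Rightarrow> 'a \<Rightarrow> real" where
  "emon \<gamma> = monomial (concat (map (\<lambda>i. replicate (\<gamma> ! i) i) [0..<Suc m]))"

text \<open>Kronecker substitution: the coordinates of the point are the powers \<open>T ^ (q ^ i)\<close>, so that
  distinct exponent vectors give distinct powers of \<open>T\<close>.\<close>

lemma emon_eval:
  assumes "\<And>i. i \<le> m \<Longrightarrow> L i x = T ^ (q ^ i)"
  shows "emon \<gamma> x = T ^ (\<Sum>i<Suc m. \<gamma> ! i * q ^ i)"
proof -
  have rep: "monomial (replicate k i) x = L i x ^ k" for k i
    by (induction k) auto
  have "monomial (concat (map (\<lambda>i. replicate (\<gamma> ! i) i) [0..<k])) x = T ^ (\<Sum>i<k. \<gamma> ! i * q ^ i)"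
    if "k \<le> Suc m" for k
    using that
  proof (induction k)
    case (Suc k)
    then show ?case
      using assms[of k] by (simp add: rep power_add power_mult[symmetric] mult.commute)
  qed simp
  from this[of "Suc m"] show ?thesis by (simp add: emon_def)
qed

lemma emon_V:
  assumes "length \<gamma> = Suc m" "sum_list \<gamma> = n"
  shows "emon \<gamma> \<in> V n"
  unfolding emon_def
proof (rule monomial_V)
  show "set (concat (map (\<lambda>i. replicate (\<gamma> ! i) i) [0..<Suc m])) \<subseteq> {..2 * m}"
    by auto
  have "length (concat (map (\<lambda>i. replicate (\<gamma> ! i) i) [0..<Suc m])) = (\<Sum>i\<leftarrow>[0..<Suc m]. \<gamma> ! i)"
    by (simp only: length_concat map_map comp_def length_replicate)
  also have "\<dots> = n" using assms by (metis map_nth)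
  finally show "length (concat (map (\<lambda>i. replicate (\<gamma> ! i) i) [0..<Suc m])) = n" .
qed

text \<open>Symmetrised pairs of monomials in the coordinates \<open>L 0\<close> to
  \<open>L m\<close>, one for each unordered pair, are linearly independent, and there are at least
  half as many of them as ordered pairs.\<close>

lemma S_large:
  assumes "finite G" "S n \<subseteq> span G"
  shows "((n + m) choose m) ^ 2 \<le> 2 * card G"
proof -
  define Q where "Q = {\<gamma>::nat list. length \<gamma> = Suc m \<and> sum_list \<gamma> = n}"
  \<comment> \<open>Exponents in degree \<open>n\<close> are at most \<open>n\<close>, so they can
    serve as digits in base \<open>Suc n\<close>.\<close>
  define \<kappa> where "\<kappa> \<gamma> = (\<Sum>i<Suc m. \<gamma> ! i * Suc n ^ i)" for \<gamma> :: "nat list"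
  have small: "x < Suc n" if "\<gamma> \<in> Q" "x \<in> set \<gamma>" for \<gamma> x
    using that member_le_sum_list[of x \<gamma>] by (auto simp: Q_def)
  have inj: "inj_on \<kappa> Q"
    using small by (intro inj_onI digits_inj[where q = "Suc n"]) (auto simp: Q_def \<kappa>_def)
  have cQ: "card Q = (n + m) choose m"
    using card_length_sum_list[of "Suc m" n] binomial_symmetric[of n "n + m"] by (simp add: Q_def)
  then have fQ: "finite Q" by (metis card.infinite binomial_eq_0_iff le_add2 not_less)
  \<comment> \<open>One representative of each unordered pair, chosen by comparing codes.\<close>
  define P where "P = {(\<gamma>, \<delta>). \<gamma> \<in> Q \<and> \<delta> \<in> Q \<and> \<kappa> \<gamma> \<le> \<kappa> \<delta>}"
  have fP: "finite P" by (rule finite_subset[of _ "Q \<times> Q"]) (use fQ P_def in auto)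
  have "Q \<times> Q \<subseteq> P \<union> prod.swap ` P"
    by (force simp: P_def image_iff)
  then have "card (Q \<times> Q) \<le> card (P \<union> prod.swap ` P)"
    by (rule card_mono[rotated]) (use fP in auto)
  also have "\<dots> \<le> card P + card P"
    by (rule order_trans[OF card_Un_le add_left_mono[OF card_image_le[OF fP]]])
  finally have QP: "card Q ^ 2 \<le> 2 * card P" by (simp add: card_cartesian_product power2_eq_square)
  have "card P \<le> card G"
  proof (rule family_card_le[OF fP assms(1), of "\<lambda>(\<gamma>, \<delta>). sprod (emon \<gamma>) (emon \<delta>)"])
    show "(\<lambda>(\<gamma>, \<delta>). sprod (emon \<gamma>) (emon \<delta>)) ` P \<subseteq> span G"
      using assms(2) by (auto simp: P_def Q_def intro!: subsetD[OF assms(2)] sprod_S emon_V)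
  next
    fix u assume u0: "(\<Sum>p\<in>P. u p *\<^sub>R (case p of (\<gamma>, \<delta>) \<Rightarrow> sprod (emon \<gamma>) (emon \<delta>))) = 0"
    \<comment> \<open>The coefficient of
      \<open>T ^ \<kappa> \<gamma> * U ^ \<kappa> \<delta>\<close> in the expanded relation. Within
      \<open>Q\<close> both summands are present only on the diagonal, where they add up to
      \<open>2 * u (\<gamma>, \<gamma>)\<close>.\<close>
    define c where "c = (\<lambda>\<gamma> \<delta>. (if \<kappa> \<gamma> \<le> \<kappa> \<delta> then u (\<gamma>, \<delta>) else 0) + (if \<kappa> \<delta> \<le> \<kappa> \<gamma> then u (\<delta>, \<gamma>) else 0))"
    have c0: "(\<Sum>\<gamma>\<in>Q. \<Sum>\<delta>\<in>Q. c \<gamma> \<delta> * (T ^ \<kappa> \<gamma> * U ^ \<kappa> \<delta>)) = 0" for T U :: real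
    proof -
      obtain x where x: "\<And>i. i \<le> m \<Longrightarrow> L i x = T ^ (Suc n ^ i)"
        using L_coord[of "\<lambda>i. T ^ (Suc n ^ i)"] by auto
      obtain y where y: "\<And>i. i \<le> m \<Longrightarrow> L i y = U ^ (Suc n ^ i)"
        using L_coord[of "\<lambda>i. U ^ (Suc n ^ i)"] by auto
      have e: "emon \<gamma> x = T ^ \<kappa> \<gamma>" "emon \<gamma> y = U ^ \<kappa> \<gamma>" for \<gamma>
        unfolding \<kappa>_def using emon_eval x y by blast+
      have PQ: "(\<Sum>p\<in>P. case p of (\<gamma>, \<delta>) \<Rightarrow> F \<gamma> \<delta>) = (\<Sum>\<gamma>\<in>Q. \<Sum>\<delta>\<in>Q. if \<kappa> \<gamma> \<le> \<kappa> \<delta> then F \<gamma> \<delta> else 0)"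
        for F :: "nat list \<Rightarrow> nat list \<Rightarrow> real"
        unfolding sum.cartesian_product using fQ
        by (intro sum.mono_neutral_cong_left) (auto simp: P_def split: if_splits)
      have "0 = (\<Sum>p\<in>P. u p *\<^sub>R (case p of (\<gamma>, \<delta>) \<Rightarrow> sprod (emon \<gamma>) (emon \<delta>))) (x, y)"
        by (simp add: u0)
      also have "\<dots> = (\<Sum>p\<in>P. case p of (\<gamma>, \<delta>) \<Rightarrow> u (\<gamma>, \<delta>) * (T ^ \<kappa> \<gamma> * U ^ \<kappa> \<delta>))
         + (\<Sum>p\<in>P. case p of (\<gamma>, \<delta>) \<Rightarrow> u (\<gamma>, \<delta>) * (T ^ \<kappa> \<delta> * U ^ \<kappa> \<gamma>))"
        unfolding sum_fun_apply sum.distrib[symmetric]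
        by (intro sum.cong) (auto simp: sprod_def e algebra_simps)
      also have "\<dots> = (\<Sum>\<gamma>\<in>Q. \<Sum>\<delta>\<in>Q. if \<kappa> \<gamma> \<le> \<kappa> \<delta> then u (\<gamma>, \<delta>) * (T ^ \<kappa> \<gamma> * U ^ \<kappa> \<delta>) else 0)
         + (\<Sum>\<gamma>\<in>Q. \<Sum>\<delta>\<in>Q. if \<kappa> \<delta> \<le> \<kappa> \<gamma> then u (\<delta>, \<gamma>) * (T ^ \<kappa> \<gamma> * U ^ \<kappa> \<delta>) else 0)"
        unfolding PQ by (subst (2) sum.swap) (rule refl)
      also have "\<dots> = (\<Sum>\<gamma>\<in>Q. \<Sum>\<delta>\<in>Q. c \<gamma> \<delta> * (T ^ \<kappa> \<gamma> * U ^ \<kappa> \<delta>))"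
        unfolding sum.distrib[symmetric] by (intro sum.cong refl) (auto simp: c_def algebra_simps)
      finally show ?thesis by simp
    qed
    have cz: "c \<gamma> \<delta> = 0" if "\<gamma> \<in> Q" "\<delta> \<in> Q" for \<gamma> \<delta>
    proof -
      define r where "r = inv_into Q \<kappa>"
      have r: "r (\<kappa> \<gamma>) = \<gamma>" if "\<gamma> \<in> Q" for \<gamma> using inj that by (simp add: r_def)
      have "c (r (\<kappa> \<gamma>)) (r (\<kappa> \<delta>)) = 0"
      proof (rule power_sum_zero2[of "\<kappa> ` Q" "\<lambda>a b. c (r a) (r b)"])
        fix T U :: real
        show "(\<Sum>a\<in>\<kappa> ` Q. \<Sum>b\<in>\<kappa> ` Q. c (r a) (r b) * (T ^ a * U ^ b)) = 0"
          using c0[of T U] by (simp add: sum.reindex[OF inj] r)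
      qed (use that fQ in auto)
      then show ?thesis using that r by simp
    qed
    show "\<forall>p\<in>P. u p = 0"
    proof clarify
      fix \<gamma> \<delta> assume p: "(\<gamma>, \<delta>) \<in> P"
      then have "c \<gamma> \<delta> = 0" using cz by (auto simp: P_def)
      moreover have "\<gamma> = \<delta>" if "\<kappa> \<delta> \<le> \<kappa> \<gamma>" using p that inj by (auto simp: P_def dest: inj_onD)
      ultimately show "u (\<gamma>, \<delta>) = 0" using p by (auto simp: c_def P_def split: if_splits)
    qed
  qed
  then show ?thesis using QP cQ by simp
qed

lemma V_rich:
  assumes "n \<ge> m"
  shows "V n = span (monomial ` {w \<in> W {..<2 * m} n. card (set w) \<ge> m})"
proof -
  define R where "R s = {w \<in> W {..<2 * m} n. card (set w) \<ge> s}" for s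
  \<comment> \<open>The letter \<open>2 * m\<close> is removed first; the letters in
    \<open>{..m}\<close> suffice and lie below \<open>2 * m\<close> because
    \<open>m \<ge> 1\<close>.\<close>
  have base: "monomial w \<in> span (monomial ` R 0)" if "set w \<subseteq> {..2 * m}" "length w = n" for w
  proof -
    have "monomial w \<in> span (monomial ` W {..<2 * m} (length w))" using that(1)
    proof (induction w)
      case Nil
      show ?case by (intro span_base imageI W_I) auto
    next
      case (Cons i w)
      have "L i \<in> span (L ` {..m})" using Cons.prems by (intro L_span) auto
      then have "L i * monomial w \<in> span {a * b |a b. a \<in> L ` {..m} \<and> b \<in> monomial ` W {..<2 * m} (length w)}"
        using Cons by (intro span_mult_span) auto
      also have "\<dots> \<subseteq> span (monomial ` W {..<2 * m} (length (i # w)))"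
      proof (rule span_mono, clarify)
        fix j v assume "j \<le> m" "v \<in> W {..<2 * m} (length w)"
        then show "L j * monomial v \<in> monomial ` W {..<2 * m} (length (i # w))"
          using m by (intro image_eqI[of _ _ "j # v"]) (auto simp: W_def)
      qed
      finally show ?case by (simp only: monomial_simps)
    qed
    then show ?thesis using that(2) by (simp add: R_def)
  qed
  have step: "monomial ` R s \<subseteq> span (monomial ` R (Suc s))" if s: "s < m" for s
  proof clarify
    fix w assume w: "w \<in> R s"
    show "monomial w \<in> span (monomial ` R (Suc s))"
    proof (cases "card (set w) \<ge> Suc s")
      case True
      then show ?thesis using w by (intro span_base imageI) (simp add: R_def)
    next
      case False
      then have card: "card (set w) = s" and ww: "set w \<subseteq> {..<2 * m}" "length w = n"
        using w by (auto simp: R_def W_def)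
      then have "\<not> distinct w" using s assms by (auto dest: distinct_card)
      then obtain xs ys zs y where y: "w = xs @ [y] @ ys @ [y] @ zs" using not_distinct_decomp by blast
      have "card ({..<2 * m} - set w) = 2 * m - s"
        using card ww(1) by (simp add: card_Diff_subset)
      then have "Suc m \<le> card ({..<2 * m} - set w)" using s by simp
      then obtain K where K: "K \<subseteq> {..<2 * m} - set w" "card K = Suc m"
        using obtain_subset_with_card_n by metis
      \<comment> \<open>Only one of the two copies of \<open>y\<close> is removed; the other keeps
        the set of letters intact.\<close>
      define r where "r = xs @ ys @ [y] @ zs"
      have "K \<subseteq> {..2 * m}" using K(1) by auto
      then have "L y \<in> span (L ` K)" using ww(1) K(2) by (intro L_span) (auto simp: y)
      then have "monomial r * L y \<in> span ((*) (monomial r) ` L ` K)" by (rule span_image_mult)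
      moreover have "(*) (monomial r) ` L ` K \<subseteq> monomial ` R (Suc s)"
      proof clarify
        fix k assume k: "k \<in> K"
        have "set (k # r) = insert k (set w)" by (auto simp: r_def y)
        then have "card (set (k # r)) = Suc s" using k K(1) card by auto
        moreover have "set (k # r) \<subseteq> {..<2 * m}" using k K(1) ww(1) by (auto simp: r_def y)
        moreover have "length (k # r) = n" using ww(2) by (simp add: r_def y)
        ultimately have "k # r \<in> R (Suc s)" by (simp add: R_def W_def)
        then show "monomial r * L k \<in> monomial ` R (Suc s)"
          by (intro image_eqI[of _ _ "k # r"]) (simp_all add: mult.commute)
      qed
      moreover have "monomial w = monomial r * L y" by (simp add: y r_def mult_ac)
      ultimately show ?thesis using span_mono by (metis subsetD)
    qed
  qed
  have "monomial ` R 0 \<subseteq> span (monomial ` R s)" if "s \<le> m" for s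
    using that
  proof (induction s)
    case 0 show ?case by (rule span_superset)
  next
    case (Suc s)
    then have "monomial ` R 0 \<subseteq> span (monomial ` R s)" by simp
    also have "\<dots> \<subseteq> span (monomial ` R (Suc s))"
      using step[of s] Suc.prems by (intro span_minimal) auto
    finally show ?case .
  qed
  from this[of m] have "span (monomial ` R 0) \<subseteq> span (monomial ` R m)" by (simp add: span_minimal)
  then have "V n \<subseteq> span (monomial ` R m)"
    unfolding V_def using base by (intro span_minimal) (auto simp: W_def)
  moreover have "span (monomial ` R m) \<subseteq> V n"
    unfolding V_def
  proof (intro span_mono image_mono)
    have "{..<2 * m} \<subseteq> {..2 * m}" by auto
    then show "R m \<subseteq> W {..2 * m} n" unfolding R_def W_def by blast
  qed
  ultimately show ?thesis by (simp add: R_def)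
qed

text \<open>The zeros of the system \<open>H i\<close>, \<open>i < 2 * m\<close>, correspond to the splittings of \<open>{..<2 * m}\<close> into
  two sets of size \<open>m\<close>; \<open>H (2 * m)\<close> does not vanish at any of them.\<close>

definition H :: "nat \<Rightarrow> 'a \<times> 'a \<Rightarrow> real" where
  "H i = (\<lambda>(x, y). L i x * L i y)"

lemma H_mult: "H i * sprod f g = sprod (L i * f) (L i * g)"
  by (auto simp: H_def sprod_def algebra_simps)

lemma H_eq: "H i = (1/2) *\<^sub>R sprod (L i) (L i)"
  by (auto simp: H_def sprod_def)

lemma H_S: "i \<le> 2 * m \<Longrightarrow> H i \<in> S 1"
  unfolding H_eq by (intro subspace_scale[OF S_subspace] sprod_S L_V)

lemma S_fin: "\<exists>G. finite G \<and> S n \<subseteq> span G"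
  unfolding S_def using S_generators by blast

lemma graded: "d \<ge> 1 \<Longrightarrow> (\<And>i. i < 2 * m \<Longrightarrow> B i \<in> S 1) \<Longrightarrow> graded_system S (2 * m) d B (H (2 * m))"
  by unfold_locales (use S_subspace S_mult S_gen H_S S_fin in simp_all)

interpretation HS: graded_system S "2 * m" m H "H (2 * m)"
  by (rule graded[OF m]) (rule H_S, simp)

lemma HS_I_mem:
  assumes "j < 2 * m" "f \<in> S (n - 1)"
  shows "H j * f \<in> HS.I n"
proof -
  have "(\<Sum>i<2 * m. H i * (if i = j then f else 0)) \<in> HS.I n"
    using assms S_subspace by (intro HS.I_memI) (auto simp: subspace_0)
  also have "(\<Sum>i<2 * m. H i * (if i = j then f else 0)) = H j * f"
    using assms by (simp add: if_distrib[of "\<lambda>x. _ * x"] cong: if_cong)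
  finally show ?thesis .
qed

text \<open>A letter occurring in both factors splits off as \<open>H j\<close>, by
  \<open>H_mult\<close>.\<close>

lemma shared_letter:
  assumes "j < 2 * m" "j \<in> set w'" "set w' \<subseteq> {..2 * m}" "length w' = n" "f \<in> V (n - 1)"
  shows "sprod (L j * f) (monomial w') \<in> HS.I n"
proof -
  have "set (remove1 j w') \<subseteq> {..2 * m}" using set_remove1_subset assms(3) by fast
  then have "monomial (remove1 j w') \<in> V (n - 1)"
    using assms by (intro monomial_V) (auto simp: length_remove1)
  then have "H j * sprod f (monomial (remove1 j w')) \<in> HS.I n"
    using assms by (intro HS_I_mem sprod_S)
  then show ?thesis by (simp add: H_mult monomial_remove1[OF assms(2)])
qed

text \<open>Letters outside \<open>T\<close> are interchangeable modulo the ideal once the other factor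
  contains all letters of \<open>T\<close>, because modulo the forms \<open>L j\<close>, \<open>j \<in> T\<close>, only one form is left.\<close>

lemma replace_letters:
  assumes Y: "subspace Y" "HS.I n \<subseteq> Y"
    and T: "T \<subseteq> {..<2 * m}" "card T = m" "T \<subseteq> set w'" "set w' \<subseteq> {..2 * m}" "length w' = n"
    and w: "set w \<subseteq> {..2 * m} - T" "set v \<subseteq> {..2 * m} - T" "length w = n" "length v = n"
    and mem: "sprod (monomial v) (monomial w') \<in> Y"
  shows "sprod (monomial w) (monomial w') \<in> Y"
proof -
  have step: "sprod (L i * f) (monomial w') \<in> Y"
    if "i \<in> {..2 * m} - T" "i' \<in> {..2 * m} - T" "f \<in> V (n - 1)" "sprod (L i' * f) (monomial w') \<in> Y" for i i' f
  proof -
    have fT: "finite T" using T(1) finite_subset by blast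
    have "L i \<in> span (L ` insert i' T)"
      using that T(1,2) fT by (intro L_span) auto
    then show ?thesis
    proof (induction rule: span_induct_alt)
      case base
      then show ?case using Y(1) unfolding mult_zero_left sprod_zero by (rule subspace_0)
    next
      case (step c x y)
      have "sprod (x * f) (monomial w') \<in> Y"
        using step(1) that(4) shared_letter[OF _ _ T(4,5) that(3)] T(1,3) Y(2) by auto
      then have "c *\<^sub>R sprod (x * f) (monomial w') + sprod (y * f) (monomial w') \<in> Y"
        using step(2) by (intro subspace_add[OF Y(1)] subspace_scale[OF Y(1)])
      then show ?case by (simp only: distrib_right sprod_add mult_scaleR_left sprod_scale)
    qed
  qed
  \<comment> \<open>The suffix \<open>u\<close> holds letters that are not exchanged at the current
    stage: the induction first treats the tail with \<open>i'\<close> moved into the suffix, and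
    then \<open>i'\<close> is turned into \<open>i\<close>.\<close>
  have "length w = length v" using w by simp
  then have "sprod (monomial (w @ u)) (monomial w') \<in> Y"
    if "length (w @ u) = n" "set u \<subseteq> {..2 * m}" "set w \<subseteq> {..2 * m} - T" "set v \<subseteq> {..2 * m} - T"
      "sprod (monomial (v @ u)) (monomial w') \<in> Y" for u
    using that
  proof (induction w v arbitrary: u rule: list_induct2)
    case (Cons i w i' v)
    have "sprod (monomial (w @ (i' # u))) (monomial w') \<in> Y"
      using Cons.prems by (intro Cons.IH) (auto simp: mult_ac)
    then have "sprod (L i' * monomial (w @ u)) (monomial w') \<in> Y" by (simp add: mult_ac)
    moreover have "monomial (w @ u) \<in> V (n - 1)"
      using Cons.prems by (intro monomial_V) auto
    ultimately have "sprod (L i * monomial (w @ u)) (monomial w') \<in> Y"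
      using Cons.prems by (intro step[of i i']) auto
    then show ?case by (simp only: monomial_simps append_Cons)
  qed simp
  from this[of "[]"] show ?thesis using w mem by simp
qed

text \<open>After \<open>V_rich\<close> both words have at least \<open>m\<close> distinct letters
  among \<open>2 * m\<close>. A shared letter puts the product into the ideal; otherwise the words
  form a splitting, and only these remain to be checked.\<close>

lemma rich_pairs:
  assumes Y: "subspace Y" "HS.I n \<subseteq> Y" and n: "n \<ge> m"
    and pairs: "\<And>w w'. set w \<subseteq> {..<2 * m} \<Longrightarrow> length w = n \<Longrightarrow> length w' = n \<Longrightarrow> set w' = {..<2 * m} - set w
      \<Longrightarrow> card (set w) = m \<Longrightarrow> card (set w') = m \<Longrightarrow> sprod (monomial w) (monomial w') \<in> Y"
  shows "S n \<subseteq> Y"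
proof -
  let ?R = "monomial ` {w \<in> W {..<2 * m} n. card (set w) \<ge> m}"
  have "S n \<subseteq> span {sprod a b |a b. a \<in> ?R \<and> b \<in> ?R}"
    unfolding S_def
  proof (rule span_minimal[OF _ subspace_span], clarify)
    fix w w' assume "w \<in> W {..2 * m} n" "w' \<in> W {..2 * m} n"
    then have "monomial w \<in> V n" "monomial w' \<in> V n" by (auto simp: W_def intro: monomial_V)
    then show "sprod (monomial w) (monomial w') \<in> span {sprod a b |a b. a \<in> ?R \<and> b \<in> ?R}"
      unfolding V_rich[OF n] by (rule sprod_span)
  qed
  also have "\<dots> \<subseteq> Y"
  proof (rule span_minimal[OF _ Y(1)], clarify)
    fix w w' assume "w \<in> W {..<2 * m} n" "w' \<in> W {..<2 * m} n" and c: "m \<le> card (set w)" "m \<le> card (set w')"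
    then have ww: "set w \<subseteq> {..<2 * m}" "set w' \<subseteq> {..<2 * m}" "length w = n" "length w' = n"
      by (auto simp: W_def)
    show "sprod (monomial w) (monomial w') \<in> Y"
    proof (cases "set w \<inter> set w' = {}")
      case True
      have "card (set w) + card (set w') \<le> 2 * m"
        using card_mono[of "{..<2 * m}" "set w \<union> set w'"] ww card_Un_disjoint[OF _ _ True] by simp
      then have c': "card (set w) = m" "card (set w') = m" using c by auto
      have "set w' = {..<2 * m} - set w"
      proof (rule card_subset_eq)
        show "card (set w') = card ({..<2 * m} - set w)" using ww c' by (simp add: card_Diff_subset)
      qed (use True ww in auto)
      then show ?thesis using pairs ww c' by blast
    next
      case False
      then obtain j where j: "j \<in> set w" "j \<in> set w'" by blast
      have "set (remove1 j w) \<subseteq> {..2 * m}" using set_remove1_subset ww(1) by fastforce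
      then have "monomial (remove1 j w) \<in> V (n - 1)"
        using ww j by (intro monomial_V) (auto simp: length_remove1)
      moreover have "set w' \<subseteq> {..2 * m}" using ww by auto
      ultimately have "sprod (L j * monomial (remove1 j w)) (monomial w') \<in> HS.I n"
        using j ww by (intro shared_letter) auto
      then show ?thesis using Y(2) monomial_remove1[OF j(1)] by auto
    qed
  qed
  finally show ?thesis .
qed

lemma word_exists:
  fixes J :: "nat set"
  assumes "finite J" "card J = m" "n \<ge> m"
  shows "\<exists>w. set w = J \<and> length w = n"
proof -
  have "J \<noteq> {}" using m assms(2) by auto
  then obtain j where "j \<in> J" by blast
  then show ?thesis
    using assms by (intro exI[of _ "sorted_list_of_set J @ replicate (n - m) j"]) auto
qed

text \<open>One generator per splitting suffices: by \<open>replace_letters\<close>, applied to each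
  factor in turn, only the two sets of letters matter. The condition \<open>0 \<in> J\<close>
  selects one half of each splitting, which leaves at most
  \<open>(2 * m - 1) choose (m - 1) = e\<close> generators.\<close>

lemma split_points_span:
  assumes e: "2 * e = (2 * m) choose m"
  obtains C where "finite C" "card C \<le> e" "C \<subseteq> S m" "\<And>x. x \<in> S m \<Longrightarrow> \<exists>w \<in> span C. x - w \<in> HS.I m"
proof -
  define word where "word J = (SOME w. set w = J \<and> length w = m)" for J :: "nat set"
  have "set (word J) = J \<and> length (word J) = m" if "finite J" "card J = m" for J
    unfolding word_def by (rule someI_ex[OF word_exists[OF that order_refl]])
  then have word: "set (word J) = J" "length (word J) = m" if "finite J" "card J = m" for J
    using that by blast+
  define J0 where "J0 = {J. J \<subseteq> {..<2 * m} \<and> card J = m \<and> 0 \<in> J}"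
  define C where "C = (\<lambda>J. sprod (monomial (word J)) (monomial (word ({..<2 * m} - J)))) ` J0"
  define Y where "Y = {x. \<exists>w \<in> span C. x - w \<in> HS.I m}"
  have finJ: "finite J" if "J \<in> J0" for J using that finite_subset[of J "{..<2 * m}"] by (auto simp: J0_def)
  have cJ: "card ({..<2 * m} - J) = m" if "J \<in> J0" for J
    using that finJ[OF that] by (simp add: J0_def card_Diff_subset)
  have fin: "finite J0" unfolding J0_def by (rule finite_subset[of _ "Pow {..<2 * m}"]) auto
  have cardJ0: "card J0 \<le> e"
  proof -
    have "J0 \<subseteq> insert 0 ` {K. K \<subseteq> {1..<2 * m} \<and> card K = m - 1}"
    proof
      fix J assume J: "J \<in> J0"
      have "J - {0} \<subseteq> {1..<2 * m}" using J by (auto simp: J0_def Suc_le_eq)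
      moreover have "card (J - {0}) = m - 1" using J finJ[OF J] by (simp add: J0_def)
      moreover have "J = insert 0 (J - {0})" using J by (auto simp: J0_def)
      ultimately show "J \<in> insert 0 ` {K. K \<subseteq> {1..<2 * m} \<and> card K = m - 1}" by blast
    qed
    then have "card J0 \<le> card {K. K \<subseteq> {1..<2 * m} \<and> card K = m - 1}"
      by (rule surj_card_le[rotated]) simp
    also have "\<dots> = (2 * m - 1) choose (m - 1)"
      using n_subsets[of "{1..<2 * m}" "m - 1"] by simp
    also have "\<dots> = e"
    proof -
      have "(2 * m) choose m = ((2 * m - 1) choose (m - 1)) + ((2 * m - 1) choose m)"
        using m choose_reduce_nat[of "2 * m" m] by simp
      moreover have "(2 * m - 1) choose m = (2 * m - 1) choose (m - 1)"
        using binomial_symmetric[of m "2 * m - 1"] m by (simp add: numeral_2_eq_2)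
      ultimately show ?thesis using e by simp
    qed
    finally show ?thesis .
  qed
  have Ysub: "subspace Y" unfolding Y_def by (intro ideal_plus_subspace HS.I_subspace subspace_span)
  have IY: "HS.I m \<subseteq> Y" by (auto simp: Y_def intro!: bexI[of _ 0] span_zero)
  have CY: "C \<subseteq> Y"
    using subspace_0[OF HS.I_subspace] by (auto simp: Y_def intro!: bexI[of _ "_ :: 'a \<times> 'a \<Rightarrow> real"] span_base)
  have key: "sprod (monomial w) (monomial w') \<in> Y"
    if w: "set w \<subseteq> {..<2 * m}" "length w = m" "length w' = m" "set w' = {..<2 * m} - set w"
      "card (set w) = m" "card (set w') = m" "0 \<in> set w" for w w'
  proof -
    have J: "set w \<in> J0" using w by (simp add: J0_def)
    have s: "set (word (set w)) = set w" "length (word (set w)) = m"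
      "set (word (set w')) = set w'" "length (word (set w')) = m"
      using word w by auto
    show ?thesis
    proof (rule replace_letters[OF Ysub IY, where T = "set w'" and v = "word (set w)"])
      show "sprod (monomial (word (set w))) (monomial w') \<in> Y"
        unfolding sprod_commute[of "monomial (word (set w))"]
      proof (rule replace_letters[OF Ysub IY, where T = "set w" and v = "word (set w')"])
        show "sprod (monomial (word (set w'))) (monomial (word (set w))) \<in> Y"
          unfolding sprod_commute[of "monomial (word (set w'))"]
          using CY J by (auto simp: C_def w(4))
      qed (use w s in auto)
    qed (use w s in auto)
  qed
  have "S m \<subseteq> Y"
  proof (rule rich_pairs[OF Ysub IY order_refl])
    fix w w' assume w: "set w \<subseteq> {..<2 * m}" "length w = m" "length w' = m" "set w' = {..<2 * m} - set w"
      "card (set w) = m" "card (set w') = m"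
    show "sprod (monomial w) (monomial w') \<in> Y"
    proof (cases "0 \<in> set w")
      case True then show ?thesis using key w by blast
    next
      case False
      have "sprod (monomial w') (monomial w) \<in> Y"
        by (rule key) (use w m False in auto)
      then show ?thesis by (simp add: sprod_commute)
    qed
  qed
  moreover have "C \<subseteq> S m"
  proof -
    have "sprod (monomial (word J)) (monomial (word ({..<2 * m} - J))) \<in> S m" if "J \<in> J0" for J
    proof (intro sprod_S monomial_V)
      have J: "finite J" "card J = m" "finite ({..<2 * m} - J)" "card ({..<2 * m} - J) = m" "J \<subseteq> {..<2 * m}"
        using finJ[OF that] cJ[OF that] that by (auto simp: J0_def)
      show "set (word J) \<subseteq> {..2 * m}" "length (word J) = m"
        "set (word ({..<2 * m} - J)) \<subseteq> {..2 * m}" "length (word ({..<2 * m} - J)) = m"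
        using word[OF J(1,2)] word[OF J(3,4)] J(5) by auto
    qed
    then show ?thesis by (auto simp: C_def)
  qed
  moreover have "finite C" "card C \<le> e"
    using fin cardJ0 card_image_le[OF fin] by (auto simp: C_def intro: order_trans)
  ultimately show thesis by (intro that[of C]) (auto simp: Y_def)
qed

text \<open>In degree \<open>Suc m\<close> each word of a splitting has a letter to spare. As
  \<open>2 * m\<close> lies outside both halves, \<open>replace_letters\<close> brings it into
  either word, and there it splits off as \<open>H (2 * m)\<close>.\<close>

lemma split_points_top:
  assumes "x \<in> S (Suc m)"
  shows "\<exists>w \<in> (*) (H (2 * m)) ` S m. x - w \<in> HS.I (Suc m)"
proof -
  define Y where "Y = {x. \<exists>w \<in> (*) (H (2 * m)) ` S m. x - w \<in> HS.I (Suc m)}"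
  have lS: "subspace ((*) (H (2 * m)) ` S m)"
    by (intro linear_subspace_image S_subspace linearI) (simp_all add: distrib_left)
  have Ysub: "subspace Y" unfolding Y_def by (intro ideal_plus_subspace HS.I_subspace lS)
  have IY: "HS.I (Suc m) \<subseteq> Y" unfolding Y_def by (intro subsetI CollectI bexI[OF _ subspace_0[OF lS]]) simp
  have "S (Suc m) \<subseteq> Y"
  proof (rule rich_pairs[OF Ysub IY])
    fix w w' assume w: "set w \<subseteq> {..<2 * m}" "length w = Suc m" "length w' = Suc m" "set w' = {..<2 * m} - set w"
      "card (set w) = m" "card (set w') = m"
    obtain u where u: "set u = set w" "length u = m" using word_exists[of "set w" m] w by auto
    obtain u' where u': "set u' = set w'" "length u' = m" using word_exists[of "set w'" m] w by auto
    have su: "set u \<subseteq> {..2 * m}" "set u' \<subseteq> {..2 * m}" using w(1,4) u(1) u'(1) by auto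
    have uV: "monomial u \<in> V m" "monomial u' \<in> V m" by (intro monomial_V su u(2) u'(2))+
    show "sprod (monomial w) (monomial w') \<in> Y"
    proof (rule replace_letters[OF Ysub IY, where T = "set w'" and v = "2 * m # u"])
      show "sprod (monomial (2 * m # u)) (monomial w') \<in> Y"
        unfolding sprod_commute[of "monomial (2 * m # u)"]
      proof (rule replace_letters[OF Ysub IY, where T = "set w" and v = "2 * m # u'"])
        have "sprod (monomial (2 * m # u')) (monomial (2 * m # u)) \<in> (*) (H (2 * m)) ` S m"
          using sprod_S[OF uV(2,1)] by (auto simp: H_mult[symmetric])
        then show "sprod (monomial (2 * m # u')) (monomial (2 * m # u)) \<in> Y"
          unfolding Y_def
          by (intro CollectI bexI[of _ "sprod (monomial (2 * m # u')) (monomial (2 * m # u))"])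
            (simp_all only: diff_self subspace_0[OF HS.I_subspace])
      qed (use w u u' in auto)
    qed (use w u u' in auto)
  qed simp
  then show ?thesis using assms by (auto simp: Y_def)
qed

text \<open>If \<open>b a - w\<close> is the sum of the \<open>H i * g i\<close>, then
  \<open>t *\<^sub>R b a\<close> plus the sum of the \<open>P i * g i\<close> is congruent to
  \<open>t *\<^sub>R w\<close> modulo the perturbed ideal. Expanding that sum in the generators,
  with coefficients independent of \<open>t\<close>, gives the situation of
  \<open>generic_perturbation\<close>.\<close>

lemma generic_spanning:
  assumes P: "\<And>i. i < 2 * m \<Longrightarrow> P i \<in> S 1" and Z: "subspace Z" and n: "n \<ge> 1"
    and span: "\<And>x. x \<in> S n \<Longrightarrow> \<exists>w \<in> Z. x - w \<in> HS.I n"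
  shows "finite {t. \<not> (\<forall>x \<in> S n. \<exists>w \<in> Z. x - w \<in> graded_system.I S (2 * m) (\<lambda>i. t *\<^sub>R H i + P i) n)}"
proof -
  have gr: "graded_system S (2 * m) m (\<lambda>i. t *\<^sub>R H i + P i) (H (2 * m))" for t
    using P H_S by (intro graded[OF m]) (auto intro!: subspace_add[OF S_subspace] subspace_scale[OF S_subspace])
  define J where "J t = graded_system.I S (2 * m) (\<lambda>i. t *\<^sub>R H i + P i) n" for t
  define Y where "Y t = {x. \<exists>w \<in> Z. x - w \<in> J t}" for t
  have Ysub: "subspace (Y t)" for t
    unfolding Y_def J_def by (intro ideal_plus_subspace Z graded_system.I_subspace[OF gr])
  define G where "G = {sprod a b |a b. a \<in> monomial ` W {..2 * m} n \<and> b \<in> monomial ` W {..2 * m} n}"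
  have G: "finite G" "S n = span G" unfolding G_def by (rule S_generators, rule S_def)
  obtain b where bij: "bij_betw b {..<card G} G"
    using ex_bij_betw_nat_finite[OF G(1)] by (auto simp: atLeast0LessThan)
  then have b: "b ` {..<card G} = G" by (simp add: bij_betw_def)
  have bS: "b a \<in> S n" if "a < card G" for a using that b G(2) by (auto intro: span_base)
  have "\<exists>E. \<forall>t. t *\<^sub>R b a + (\<Sum>j<card G. E j *\<^sub>R b j) \<in> Y t" if a: "a < card G" for a
  proof -
    obtain w where w: "w \<in> Z" "b a - w \<in> HS.I n" using span[OF bS[OF a]] by blast
    then obtain g where g: "\<And>i. i < 2 * m \<Longrightarrow> g i \<in> S (n - 1)" "b a - w = (\<Sum>i<2 * m. H i * g i)"
      by (auto simp: HS.I_def)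
    have "(\<Sum>i<2 * m. P i * g i) \<in> S n"
      using S_mult[OF P g(1)] n by (intro subspace_sum[OF S_subspace]) simp
    then obtain u where "(\<Sum>i<2 * m. P i * g i) = (\<Sum>x\<in>G. u x *\<^sub>R x)"
      using span_finite[OF G(1)] G(2) by auto
    also have "\<dots> = (\<Sum>j<card G. u (b j) *\<^sub>R b j)"
      by (rule sum.reindex_bij_betw[OF bij, symmetric, of "\<lambda>v. u v *\<^sub>R v"])
    finally have "(\<Sum>i<2 * m. P i * g i) = (\<Sum>j<card G. u (b j) *\<^sub>R b j)" .
    then obtain E where E: "(\<Sum>i<2 * m. P i * g i) = (\<Sum>j<card G. E j *\<^sub>R b j)"
      by (rule that)
    have "t *\<^sub>R b a + (\<Sum>j<card G. E j *\<^sub>R b j) \<in> Y t" for t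
    proof -
      have "(\<Sum>i<2 * m. (t *\<^sub>R H i + P i) * g i) \<in> J t"
        unfolding J_def using g(1) by (intro graded_system.I_memI[OF gr])
      moreover have "t *\<^sub>R b a + (\<Sum>j<card G. E j *\<^sub>R b j) - t *\<^sub>R w = (\<Sum>i<2 * m. (t *\<^sub>R H i + P i) * g i)"
      proof -
        have "t *\<^sub>R b a + (\<Sum>j<card G. E j *\<^sub>R b j) - t *\<^sub>R w
            = t *\<^sub>R (b a - w) + (\<Sum>i<2 * m. P i * g i)" unfolding E by (simp add: algebra_simps)
        then show ?thesis by (simp add: g(2) distrib_right sum.distrib scaleR_sum_right)
      qed
      ultimately show ?thesis
        unfolding Y_def using subspace_scale[OF Z w(1), of t] by (auto intro!: bexI[of _ "t *\<^sub>R w"])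
    qed
    then show ?thesis by blast
  qed
  note ex = this
  define E where "E a = (SOME E. \<forall>t. t *\<^sub>R b a + (\<Sum>j<card G. E j *\<^sub>R b j) \<in> Y t)" for a
  have "t *\<^sub>R b a + (\<Sum>j<card G. E a j *\<^sub>R b j) \<in> Y t" if "a < card G" for a t
    using someI_ex[OF ex[OF that]] by (simp add: E_def)
  then have fin: "finite {t. \<exists>a<card G. b a \<notin> Y t}"
    by (rule generic_perturbation[OF Ysub])
  have "S n \<subseteq> Y t" if "\<forall>a<card G. b a \<in> Y t" for t
  proof -
    have "G \<subseteq> Y t"
    proof
      fix x assume "x \<in> G"
      then obtain a where "a < card G" "x = b a" using b by (metis imageE lessThan_iff)
      then show "x \<in> Y t" using that by simp
    qed
    then show ?thesis unfolding G(2) by (rule span_minimal[OF _ Ysub])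
  qed
  then have "\<forall>x \<in> S n. \<exists>w \<in> Z. x - w \<in> J t" if "\<not> (\<exists>a<card G. b a \<notin> Y t)" for t
    using that unfolding Y_def by blast
  then have "{t. \<not> (\<forall>x \<in> S n. \<exists>w \<in> Z. x - w \<in> J t)} \<subseteq> {t. \<exists>a<card G. b a \<notin> Y t}"
    by blast
  then show ?thesis unfolding J_def using fin by (rule finite_subset)
qed

text \<open>One set \<open>C\<close>, taken from the split system, serves every parameter outside
  two finite exceptional sets; \<open>S_large\<close> concerns \<open>S\<close> alone and is the
  same for all of them.\<close>

lemma generic_character:
  assumes P: "\<And>i. i < 2 * m \<Longrightarrow> P i \<in> S 1" and e: "2 * e = (2 * m) choose m" "odd e"
  shows "finite {t. \<not> (\<exists>lam :: nat \<Rightarrow> ('a \<times> 'a \<Rightarrow> real) \<Rightarrow> real.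
    (\<forall>k\<ge>1. \<forall>f\<in>S k. \<forall>g\<in>S k. lam k (f + g) = lam k f + lam k g) \<and>
    (\<forall>k\<ge>1. \<forall>f\<in>S k. \<forall>c. lam k (c *\<^sub>R f) = c * lam k f) \<and>
    (\<forall>j\<ge>1. \<forall>k\<ge>1. \<forall>f\<in>S j. \<forall>g\<in>S k. lam (j + k) (f * g) = lam j f * lam k g) \<and>
    (\<forall>i<2 * m. lam 1 (t *\<^sub>R H i + P i) = 0) \<and> lam 1 (H (2 * m)) = 1)}"
proof -
  obtain C where C: "finite C" "card C \<le> e" "C \<subseteq> S m" "\<And>x. x \<in> S m \<Longrightarrow> \<exists>w \<in> span C. x - w \<in> HS.I m"
    using split_points_span[OF e(1)] by blast
  have lS: "subspace ((*) (H (2 * m)) ` S m)"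
    by (intro linear_subspace_image S_subspace linearI) (simp_all add: distrib_left)
  define I where "I = (\<lambda>t. graded_system.I S (2 * m) (\<lambda>i. t *\<^sub>R H i + P i))"
  have "finite {t. \<not> (\<forall>x \<in> S m. \<exists>w \<in> span C. x - w \<in> I t m)}" (is "finite ?A")
    unfolding I_def using C(4) by (intro generic_spanning P subspace_span m)
  moreover have "finite {t. \<not> (\<forall>x \<in> S (Suc m). \<exists>w \<in> (*) (H (2 * m)) ` S m. x - w \<in> I t (Suc m))}" (is "finite ?A'")
    unfolding I_def using split_points_top by (intro generic_spanning P lS) auto
  ultimately have fin: "finite (?A \<union> ?A')" by simp
  show ?thesis
  proof (rule finite_subset[OF _ fin], rule ccontr)
    assume "\<not> {t. \<not> (\<exists>lam :: nat \<Rightarrow> ('a \<times> 'a \<Rightarrow> real) \<Rightarrow> real.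
    (\<forall>k\<ge>1. \<forall>f\<in>S k. \<forall>g\<in>S k. lam k (f + g) = lam k f + lam k g) \<and>
    (\<forall>k\<ge>1. \<forall>f\<in>S k. \<forall>c. lam k (c *\<^sub>R f) = c * lam k f) \<and>
    (\<forall>j\<ge>1. \<forall>k\<ge>1. \<forall>f\<in>S j. \<forall>g\<in>S k. lam (j + k) (f * g) = lam j f * lam k g) \<and>
    (\<forall>i<2 * m. lam 1 (t *\<^sub>R H i + P i) = 0) \<and> lam 1 (H (2 * m)) = 1)} \<subseteq> ?A \<union> ?A'"
    then obtain t where t: "\<not> (\<exists>lam :: nat \<Rightarrow> ('a \<times> 'a \<Rightarrow> real) \<Rightarrow> real.
      (\<forall>k\<ge>1. \<forall>f\<in>S k. \<forall>g\<in>S k. lam k (f + g) = lam k f + lam k g) \<and>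
      (\<forall>k\<ge>1. \<forall>f\<in>S k. \<forall>c. lam k (c *\<^sub>R f) = c * lam k f) \<and>
      (\<forall>j\<ge>1. \<forall>k\<ge>1. \<forall>f\<in>S j. \<forall>g\<in>S k. lam (j + k) (f * g) = lam j f * lam k g) \<and>
      (\<forall>i<2 * m. lam 1 (t *\<^sub>R H i + P i) = 0) \<and> lam 1 (H (2 * m)) = 1)"
      and "t \<notin> ?A" "t \<notin> ?A'" by blast
    then have 1: "\<And>x. x \<in> S m \<Longrightarrow> \<exists>w \<in> span C. x - w \<in> I t m"
      and 2: "\<And>x. x \<in> S (Suc m) \<Longrightarrow> \<exists>w \<in> (*) (H (2 * m)) ` S m. x - w \<in> I t (Suc m)" by auto
    interpret G: graded_system S "2 * m" m "\<lambda>i. t *\<^sub>R H i + P i" "H (2 * m)"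
      using P H_S by (intro graded[OF m]) (auto intro!: subspace_add[OF S_subspace] subspace_scale[OF S_subspace])
    have "G.S_top"
      unfolding G.S_top_def
    proof
      fix x assume "x \<in> S (Suc m)"
      then obtain g where "g \<in> S m" "x - H (2 * m) * g \<in> G.I (Suc m)" using 2 by (auto simp: I_def)
      then show "x \<in> {f + H (2 * m) * g |f g. f \<in> G.I (Suc m) \<and> g \<in> S m}"
        by (intro CollectI exI[of _ "x - H (2 * m) * g"] exI[of _ g]) auto
    qed
    then interpret G: odd_graded_system S "2 * m" m "\<lambda>i. t *\<^sub>R H i + P i" "H (2 * m)" m e
      using m e S_large by unfold_locales auto
    show False
    proof (rule G.graded_character[OF C(1-3)])
      show "\<exists>w\<in>span C. x - w \<in> G.I m" if "x \<in> S m" for x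
        using 1[OF that] by (simp add: I_def)
    next
      fix lam :: "nat \<Rightarrow> ('a \<times> 'a \<Rightarrow> real) \<Rightarrow> real"
      assume lam: "\<And>k f g. k \<ge> 1 \<Longrightarrow> f \<in> S k \<Longrightarrow> g \<in> S k \<Longrightarrow> lam k (f + g) = lam k f + lam k g"
        "\<And>k f c. k \<ge> 1 \<Longrightarrow> f \<in> S k \<Longrightarrow> lam k (c *\<^sub>R f) = c * lam k f"
        "\<And>j k f g. j \<ge> 1 \<Longrightarrow> k \<ge> 1 \<Longrightarrow> f \<in> S j \<Longrightarrow> g \<in> S k \<Longrightarrow> lam (j + k) (f * g) = lam j f * lam k g"
        "\<And>i. i < 2 * m \<Longrightarrow> lam 1 (t *\<^sub>R H i + P i) = 0"
        "lam 1 (H (2 * m)) = 1"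
      from t show False
        by (rule notE) (intro exI[of _ lam] conjI allI ballI impI lam; assumption)
    qed
  qed
qed

end

subsection \<open>Binomial coefficients and interpolation\<close>

text \<open>An odd coefficient would be coprime to \<open>2 ^ j\<close>, and the absorption identity
  would then make \<open>2 ^ j\<close> divide \<open>i\<close>.\<close>

lemma even_binomial_power2:
  assumes "0 < i" "i < 2 ^ j"
  shows "even ((2 ^ j) choose i)"
proof (rule ccontr)
  assume "odd ((2 ^ j) choose i)"
  then have "coprime (2 ^ j) ((2 ^ j) choose i)" by simp
  moreover have "i * ((2 ^ j) choose i) = 2 ^ j * ((2 ^ j - 1) choose (i - 1))"
    using times_binomial_minus1_eq[OF assms(1)] by simp
  then have "2 ^ j dvd i * ((2 ^ j) choose i)" by simp
  ultimately have "2 ^ j dvd i" by (simp add: coprime_dvd_mult_left_iff)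
  then show False using assms by (auto dest: dvd_imp_le)
qed

text \<open>By Pascal's rule neighbouring entries have an even sum, so all share the parity of the
  first entry.\<close>

lemma odd_binomial_power2_minus1:
  assumes "i < 2 ^ j"
  shows "odd ((2 ^ j - 1) choose i)"
  using assms
proof (induction i)
  case (Suc i)
  have "(2 ^ j) choose Suc i = ((2 ^ j - 1) choose i) + ((2 ^ j - 1) choose Suc i)"
    using binomial_Suc_Suc[of "2 ^ j - 1" i] by simp
  then show ?case using even_binomial_power2[of "Suc i" j] Suc by (metis Suc_lessD even_add zero_less_Suc)
qed simp

text \<open>Half of the central coefficient is an entry of row \<open>2 ^ (k + 1) - 1\<close>, which
  is odd throughout. This is where the special form of the dimension enters.\<close>

lemma half_central_binomial_odd:
  obtains e :: nat where "2 * e = (2 * 2 ^ k) choose (2 ^ k)" "odd e"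
proof
  define m :: nat where "m = 2 ^ k"
  have m: "m \<ge> 1" by (simp add: m_def)
  have "(2 * m) choose m = ((2 * m - 1) choose (m - 1)) + ((2 * m - 1) choose m)"
    using m choose_reduce_nat[of "2 * m" m] by simp
  moreover have "(2 * m - 1) choose m = (2 * m - 1) choose (m - 1)"
    using binomial_symmetric[of m "2 * m - 1"] m by (simp add: numeral_2_eq_2)
  ultimately show "2 * ((2 * 2 ^ k - 1) choose (2 ^ k - 1)) = (2 * 2 ^ k) choose (2 ^ k)"
    by (simp add: m_def)
  show "odd ((2 * 2 ^ k - 1) choose (2 ^ k - 1 :: nat))"
    using odd_binomial_power2_minus1[of "2 ^ k - 1" "Suc k"] by (simp add: less_imp_diff_less)
qed

definition lagrange_poly :: "nat set \<Rightarrow> nat \<Rightarrow> real poly" where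
  "lagrange_poly K k = (\<Prod>j\<in>K - {k}. Polynomial.smult (1 / (real k - real j)) [:- real j, 1:])"

lemma poly_lagrange_poly:
  assumes "finite K" "k \<in> K" "i \<in> K"
  shows "poly (lagrange_poly K k) (real i) = (if i = k then 1 else 0)"
proof (cases "i = k")
  case True
  then show ?thesis
    by (auto simp: lagrange_poly_def poly_prod diff_divide_distrib[symmetric] intro!: prod.neutral)
next
  case False
  then have "\<exists>j\<in>K - {k}. 1 / (real k - real j) * (real i - real j) = 0"
    using assms by (intro bexI[of _ i]) auto
  then show ?thesis using False assms by (simp add: lagrange_poly_def poly_prod)
qed

lemma degree_lagrange_poly:
  assumes "finite K" "k \<in> K" "card K = Suc m"
  shows "degree (lagrange_poly K k) \<le> m"
proof -
  have "degree (lagrange_poly K k) \<le> (\<Sum>j\<in>K - {k}. degree (Polynomial.smult (1 / (real k - real j)) [:- real j, 1:]))"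
    unfolding lagrange_poly_def
    using assms degree_prod_sum_le[of "K - {k}" "\<lambda>j. Polynomial.smult (1 / (real k - real j)) [:- real j, 1:]"]
    by (simp add: comp_def)
  also have "\<dots> \<le> (\<Sum>j\<in>K - {k}. 1)" by (intro sum_mono) auto
  also have "\<dots> = m" using assms by simp
  finally show ?thesis .
qed

lemma lagrange_interpolation:
  assumes "finite K" "card K = Suc m" "degree p \<le> m"
  shows "poly p z = (\<Sum>k\<in>K. poly (lagrange_poly K k) z * poly p (real k))"
proof -
  define q where "q = p - (\<Sum>k\<in>K. Polynomial.smult (poly p (real k)) (lagrange_poly K k))"
  have deg: "degree q \<le> m"
    unfolding q_def using assms degree_lagrange_poly[OF assms(1) _ assms(2)]
    by (intro degree_diff_le degree_sum_le order_trans[OF degree_smult_le]) auto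
  have roots: "poly q (real i) = 0" if "i \<in> K" for i
  proof -
    have "(\<Sum>k\<in>K. poly p (real k) * poly (lagrange_poly K k) (real i)) = (\<Sum>k\<in>K. if i = k then poly p (real k) else 0)"
      using that assms(1) by (intro sum.cong) (auto simp: poly_lagrange_poly)
    then show ?thesis using that assms(1) by (simp add: q_def poly_sum)
  qed
  have "q = 0"
  proof (rule ccontr)
    assume q: "q \<noteq> 0"
    have "card (real ` K) \<le> card {x. poly q x = 0}"
      using roots by (intro card_mono poly_roots_finite q) auto
    also have "\<dots> \<le> degree q" by (rule card_poly_roots_bound[OF q])
    finally show False using deg assms(2) by (simp add: card_image)
  qed
  then have "poly p z = poly (\<Sum>k\<in>K. Polynomial.smult (poly p (real k)) (lagrange_poly K k)) z"
    by (simp add: q_def)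
  then show ?thesis by (simp add: poly_sum mult.commute)
qed

subsection \<open>Symmetric matrices of rank at most two\<close>

definition coord :: "'n \<Rightarrow> real ^ 'n \<Rightarrow> real" where
  "coord j x = vec_nth x j"

lemma linear_expand:
  fixes f :: "real ^ 'n \<Rightarrow> real"
  assumes "linear f"
  shows "f x = (\<Sum>j\<in>UNIV. vec_nth x j * f (axis j 1))"
proof -
  have "f x = f (\<Sum>j\<in>UNIV. vec_nth x j *\<^sub>R axis j 1)"
    using basis_expansion[of x] by (simp add: scalar_mult_eq_scaleR)
  then show ?thesis by (simp add: linear_sum[OF assms] linear_scale[OF assms])
qed

definition symmetric_bilinear :: "((real ^ 'n) \<times> (real ^ 'n) \<Rightarrow> real) \<Rightarrow> bool" where
  "symmetric_bilinear \<beta> \<longleftrightarrow> (\<forall>x. linear (\<lambda>y. \<beta> (x, y))) \<and> (\<forall>x y. \<beta> (x, y) = \<beta> (y, x))"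

definition entry :: "((real ^ 'n) \<times> (real ^ 'n) \<Rightarrow> real) \<Rightarrow> 'n \<Rightarrow> 'n \<Rightarrow> real" where
  "entry \<beta> j k = \<beta> (axis j 1, axis k 1)"

lemma symmetric_bilinear_expand:
  fixes \<beta> :: "(real ^ 'n) \<times> (real ^ 'n) \<Rightarrow> real"
  assumes "symmetric_bilinear \<beta>"
  shows "\<beta> = (\<Sum>j\<in>UNIV. \<Sum>k\<in>UNIV. (entry \<beta> j k / 2) *\<^sub>R sprod (coord j) (coord k))"
proof
  fix p :: "(real ^ 'n) \<times> (real ^ 'n)"
  obtain x y where p: "p = (x, y)" by (cases p)
  have "\<beta> (x, y) = (\<Sum>k\<in>UNIV. vec_nth y k * \<beta> (x, axis k 1))" for x y
    using assms by (intro linear_expand) (auto simp: symmetric_bilinear_def)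
  moreover have "\<beta> (x, axis k 1) = (\<Sum>j\<in>UNIV. vec_nth x j * entry \<beta> j k)" for x k
  proof -
    have "\<beta> (axis k 1, x) = (\<Sum>j\<in>UNIV. vec_nth x j * \<beta> (axis k 1, axis j 1))"
      using assms by (intro linear_expand) (auto simp: symmetric_bilinear_def)
    then show ?thesis using assms by (simp add: symmetric_bilinear_def entry_def)
  qed
  ultimately have e: "\<beta> (x, y) = (\<Sum>k\<in>UNIV. \<Sum>j\<in>UNIV. entry \<beta> j k * (vec_nth x j * vec_nth y k))" for x y
    by (simp add: sum_distrib_left mult_ac)
  have "(\<Sum>j\<in>UNIV. \<Sum>k\<in>UNIV. (entry \<beta> j k / 2) *\<^sub>R sprod (coord j) (coord k)) (x, y)
     = (1/2) * (\<Sum>j\<in>UNIV. \<Sum>k\<in>UNIV. entry \<beta> j k * (vec_nth x j * vec_nth y k))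
     + (1/2) * (\<Sum>j\<in>UNIV. \<Sum>k\<in>UNIV. entry \<beta> j k * (vec_nth y j * vec_nth x k))"
    unfolding sum_distrib_left sum.distrib[symmetric] sum_fun_apply
    by (intro sum.cong refl) (simp add: sprod_def coord_def algebra_simps)
  also have "(\<Sum>j\<in>UNIV. \<Sum>k\<in>UNIV. entry \<beta> j k * (vec_nth x j * vec_nth y k)) = \<beta> (x, y)"
    unfolding e by (rule sum.swap)
  also have "(\<Sum>j\<in>UNIV. \<Sum>k\<in>UNIV. entry \<beta> j k * (vec_nth y j * vec_nth x k)) = \<beta> (y, x)"
    unfolding e by (rule sum.swap)
  finally have expand: "(\<Sum>j\<in>UNIV. \<Sum>k\<in>UNIV. (entry \<beta> j k / 2) *\<^sub>R sprod (coord j) (coord k)) (x, y)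
      = (1/2) * \<beta> (x, y) + (1/2) * \<beta> (y, x)" .
  have "\<beta> (y, x) = \<beta> (x, y)" using assms by (simp add: symmetric_bilinear_def)
  then show "\<beta> p = (\<Sum>j\<in>UNIV. \<Sum>k\<in>UNIV. (entry \<beta> j k / 2) *\<^sub>R sprod (coord j) (coord k)) p"
    unfolding p expand by simp
qed

lemma symmetric_bilinear_add: "symmetric_bilinear \<beta> \<Longrightarrow> symmetric_bilinear \<gamma> \<Longrightarrow> symmetric_bilinear (\<beta> + \<gamma>)"
  by (auto simp: symmetric_bilinear_def linear_iff algebra_simps)

lemma symmetric_bilinear_scale: "symmetric_bilinear \<beta> \<Longrightarrow> symmetric_bilinear (c *\<^sub>R \<beta>)"
  by (auto simp: symmetric_bilinear_def linear_iff algebra_simps)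

text \<open>The trace pairing of \<open>A\<close> with the matrix of \<open>\<beta>\<close>; for
  bilinear \<open>\<beta>\<close> its value at \<open>a a^T\<close> is
  \<open>\<beta> (a, a)\<close>.\<close>

definition pairing :: "((real ^ 'n) \<times> (real ^ 'n) \<Rightarrow> real) \<Rightarrow> real ^ 'n ^ 'n \<Rightarrow> real" where
  "pairing \<beta> A = (\<Sum>j\<in>UNIV. \<Sum>k\<in>UNIV. entry \<beta> j k * vec_nth (vec_nth A j) k)"

lemma pairing_scale: "pairing \<beta> (c *\<^sub>R A) = c * pairing \<beta> A"
  by (simp add: pairing_def sum_distrib_left mult_ac)

lemma pairing_add: "pairing (\<beta> + \<gamma>) A = pairing \<beta> A + pairing \<gamma> A"
  by (simp add: pairing_def entry_def algebra_simps sum.distrib)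

lemma pairing_scale_left: "pairing (c *\<^sub>R \<beta>) A = c * pairing \<beta> A"
  by (simp add: pairing_def entry_def sum_distrib_left mult_ac)

lemma tendsto_pairing: "X \<longlonglongrightarrow> A \<Longrightarrow> (\<lambda>n. pairing \<beta> (X n)) \<longlonglongrightarrow> pairing \<beta> A"
  unfolding pairing_def by (intro tendsto_intros)

section \<open>A polynomial description of rank at most two\<close>

definition matrix_form :: "real ^ 'n ^ 'n \<Rightarrow> real ^ 'n \<Rightarrow> real ^ 'n \<Rightarrow> real" where
  "matrix_form A u v = (\<Sum>j\<in>UNIV. \<Sum>k\<in>UNIV. vec_nth u j * vec_nth v k * vec_nth (vec_nth A j) k)"

lemma matrix_form_scale: "matrix_form (c *\<^sub>R A) u v = c * matrix_form A u v"
  by (simp add: matrix_form_def sum_distrib_left mult_ac)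

lemma matrix_form_add: "matrix_form A u (v + w) = matrix_form A u v + matrix_form A u w" "matrix_form A (v + w) u = matrix_form A v u + matrix_form A w u"
  by (simp_all add: matrix_form_def algebra_simps sum.distrib)

lemma matrix_form_axis: "matrix_form A (axis j 1) (axis k 1) = vec_nth (vec_nth A j) k"
proof -
  have "matrix_form A (axis j 1) (axis k 1) = (\<Sum>j'\<in>UNIV. \<Sum>k'\<in>UNIV. if j' = j \<and> k' = k then vec_nth (vec_nth A j') k' else 0)"
    unfolding matrix_form_def by (intro sum.cong refl) (auto simp: axis_def)
  also have "\<dots> = (\<Sum>j'\<in>UNIV. if j' = j then vec_nth (vec_nth A j') k else 0)"
    by (intro sum.cong refl) (auto simp: sum.delta)
  finally show ?thesis by simp
qed

lemma tendsto_matrix_form: "X \<longlonglongrightarrow> A \<Longrightarrow> (\<lambda>n. matrix_form (X n) u v) \<longlonglongrightarrow> matrix_form A u v"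
  unfolding matrix_form_def by (intro tendsto_intros)

definition mvec :: "real ^ 'n ^ 'n \<Rightarrow> real ^ 'n \<Rightarrow> real ^ 'n" where
  "mvec A u = vec_lambda (\<lambda>k. \<Sum>j\<in>UNIV. vec_nth u j * vec_nth (vec_nth A j) k)"

lemma matrix_form_mvec: "matrix_form A u v = mvec A u \<bullet> v"
proof -
  have "matrix_form A u v = (\<Sum>k\<in>UNIV. \<Sum>j\<in>UNIV. vec_nth u j * vec_nth v k * vec_nth (vec_nth A j) k)"
    unfolding matrix_form_def by (rule sum.swap)
  then show ?thesis by (simp add: mvec_def inner_vec_def sum_distrib_left mult_ac)
qed

text \<open>The Schur complement of \<open>A\<close> along \<open>\<xi>\<close>, with the
  denominator \<open>matrix_form A \<xi> \<xi>\<close> cleared.\<close>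

definition bordered_minor :: "real ^ 'n ^ 'n \<Rightarrow> real ^ 'n \<Rightarrow> real ^ 'n \<Rightarrow> real ^ 'n \<Rightarrow> real" where
  "bordered_minor A \<xi> u v = matrix_form A \<xi> \<xi> * matrix_form A u v - matrix_form A \<xi> u * matrix_form A \<xi> v"

text \<open>The condition \<open>rank2\<close> is a polynomial way of saying that \<open>A\<close> has rank at most two:
  each of the matrices \<open>bordered_minor A \<xi>\<close> has rank at most one.\<close>

definition rank2 :: "real ^ 'n ^ 'n \<Rightarrow> bool" where
  "rank2 A \<longleftrightarrow> (\<forall>u v. matrix_form A u v = matrix_form A v u) \<and>
     (\<forall>\<xi> u v u' v'. bordered_minor A \<xi> u v * bordered_minor A \<xi> u' v' = bordered_minor A \<xi> u v' * bordered_minor A \<xi> u' v)"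

lemma rank2_scale: "rank2 A \<Longrightarrow> rank2 (c *\<^sub>R A)"
proof -
  assume A: "rank2 A"
  have D: "bordered_minor (c *\<^sub>R A) \<xi> u v = c ^ 2 * bordered_minor A \<xi> u v" for \<xi> u v
    by (simp add: bordered_minor_def matrix_form_scale algebra_simps power2_eq_square)
  have "bordered_minor A \<xi> u v * bordered_minor A \<xi> u' v' = bordered_minor A \<xi> u v' * bordered_minor A \<xi> u' v" for \<xi> u v u' v'
    using A by (simp add: rank2_def)
  then have "c ^ 2 * c ^ 2 * (bordered_minor A \<xi> u v * bordered_minor A \<xi> u' v') = c ^ 2 * c ^ 2 * (bordered_minor A \<xi> u v' * bordered_minor A \<xi> u' v)"
    for \<xi> u v u' v' by simp
  then show ?thesis using A unfolding rank2_def D matrix_form_scale by (simp add: mult_ac)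
qed

lemma rank2_limit:
  assumes "X \<longlonglongrightarrow> A" "\<And>n. rank2 (X n)"
  shows "rank2 A"
  unfolding rank2_def
proof (intro conjI allI)
  fix u v
  have "(\<lambda>n. matrix_form (X n) u v) \<longlonglongrightarrow> matrix_form A v u"
    using tendsto_matrix_form[OF assms(1), of v u] assms(2) by (simp add: rank2_def)
  then show "matrix_form A u v = matrix_form A v u"
    using tendsto_matrix_form[OF assms(1), of u v] LIMSEQ_unique by blast
next
  fix \<xi> u v u' v'
  have D: "(\<lambda>n. bordered_minor (X n) \<xi> u v) \<longlonglongrightarrow> bordered_minor A \<xi> u v" for u v
    unfolding bordered_minor_def by (intro tendsto_intros tendsto_matrix_form assms(1))
  have "(\<lambda>n. bordered_minor (X n) \<xi> u v * bordered_minor (X n) \<xi> u' v') \<longlonglongrightarrow> bordered_minor A \<xi> u v' * bordered_minor A \<xi> u' v"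
    using tendsto_mult[OF D D, of u v' u' v] assms(2) unfolding rank2_def by simp
  then show "bordered_minor A \<xi> u v * bordered_minor A \<xi> u' v' = bordered_minor A \<xi> u v' * bordered_minor A \<xi> u' v"
    using tendsto_mult[OF D D, of u v u' v'] LIMSEQ_unique by blast
qed

text \<open>Completing the square twice. A direction \<open>\<xi>\<close> with nonzero value exists
  by polarisation, and what remains after the first square has rank at most one by
  \<open>rank2\<close>. The scalar \<open>\<alpha>\<close> may have either sign, which is harmless
  since the pairings with \<open>A\<close> will be zero.\<close>

lemma rank2_decomposition:
  assumes "rank2 A" "A \<noteq> 0"
  obtains \<alpha> a b s where "\<alpha> \<noteq> 0" "a \<noteq> 0" "\<And>u v. \<alpha> * matrix_form A u v = (a \<bullet> u) * (a \<bullet> v) + s * (b \<bullet> u) * (b \<bullet> v)"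
proof -
  have sym: "matrix_form A u v = matrix_form A v u" for u v using assms(1) by (simp add: rank2_def)
  have det: "bordered_minor A \<xi> u v * bordered_minor A \<xi> u' v' = bordered_minor A \<xi> u v' * bordered_minor A \<xi> u' v" for \<xi> u v u' v'
    using assms(1) by (simp add: rank2_def)
  obtain \<xi> where \<xi>: "matrix_form A \<xi> \<xi> \<noteq> 0"
  proof (rule ccontr)
    assume "\<not> thesis"
    then have z: "matrix_form A u u = 0" for u using that by blast
    have "matrix_form A u v = 0" for u v
      using z[of "u + v"] z[of u] z[of v] sym[of u v] by (simp add: matrix_form_add)
    then have "vec_nth (vec_nth A j) k = 0" for j k using matrix_form_axis by metis
    then show False using assms(2) by (simp add: Finite_Cartesian_Product.vec_eq_iff)
  qed
  define \<alpha> where "\<alpha> = matrix_form A \<xi> \<xi>"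
  define a where "a = mvec A \<xi>"
  have a: "a \<noteq> 0" using \<xi> by (auto simp: a_def matrix_form_mvec)
  have D: "bordered_minor A \<xi> u v = \<alpha> * matrix_form A u v - (a \<bullet> u) * (a \<bullet> v)" for u v
    by (simp add: bordered_minor_def \<alpha>_def a_def matrix_form_mvec[of A \<xi> u] matrix_form_mvec[of A \<xi> v])
  show thesis
  proof (cases "\<forall>u. bordered_minor A \<xi> u u = 0")
    case True
    \<comment> \<open>With crossed arguments, \<open>det\<close> expresses the square of this entry
      as a product of two diagonal entries.\<close>
    have "bordered_minor A \<xi> u v = 0" for u v
      using det[of \<xi> u v v u] True sym[of u v] by (simp add: D mult.commute)
    then show thesis
      using a \<xi> by (intro that[of \<alpha> a 0 0]) (simp_all add: D \<alpha>_def)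
  next
    case False
    then obtain w where w: "bordered_minor A \<xi> w w \<noteq> 0" by blast
    define b where "b = \<alpha> *\<^sub>R mvec A w - (a \<bullet> w) *\<^sub>R a"
    have b: "bordered_minor A \<xi> w v = b \<bullet> v" for v
      by (simp add: D b_def matrix_form_mvec inner_diff_left)
    have "bordered_minor A \<xi> w w * bordered_minor A \<xi> u v = (b \<bullet> u) * (b \<bullet> v)" for u v
      using det[of \<xi> w w u v] b[of u] b[of v] sym[of u w] by (simp add: D mult.commute)
    then have "bordered_minor A \<xi> u v = (1 / bordered_minor A \<xi> w w) * (b \<bullet> u) * (b \<bullet> v)" for u v
      using w by (simp add: field_simps)
    then have "\<alpha> * matrix_form A u v = (a \<bullet> u) * (a \<bullet> v) + (1 / bordered_minor A \<xi> w w) * (b \<bullet> u) * (b \<bullet> v)" for u v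
      using D[of u v] by (metis add.commute diff_add_cancel)
    then show thesis using a \<xi>
      by (intro that[of \<alpha> a "1 / bordered_minor A \<xi> w w" b]) (simp_all add: \<alpha>_def)
  qed
qed

lemma pairing_decomposition:
  assumes "symmetric_bilinear \<beta>" "\<alpha> \<noteq> 0" "\<And>u v. \<alpha> * matrix_form A u v = (a \<bullet> u) * (a \<bullet> v) + s * (b \<bullet> u) * (b \<bullet> v)"
  shows "\<alpha> * pairing \<beta> A = \<beta> (a, a) + s * \<beta> (b, b)"
proof -
  have e: "\<beta> (x, x) = (\<Sum>j\<in>UNIV. \<Sum>k\<in>UNIV. entry \<beta> j k * (vec_nth x j * vec_nth x k))" for x
  proof -
    have "\<beta> (x, x) = (\<Sum>j\<in>UNIV. \<Sum>k\<in>UNIV. (entry \<beta> j k / 2) *\<^sub>R sprod (coord j) (coord k)) (x, x)"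
      using fun_cong[OF symmetric_bilinear_expand[OF assms(1)], of "(x, x)"] .
    also have "\<dots> = (\<Sum>j\<in>UNIV. \<Sum>k\<in>UNIV. entry \<beta> j k * (vec_nth x j * vec_nth x k))"
      unfolding sum_fun_apply by (intro sum.cong refl) (simp add: sprod_def coord_def)
    finally show ?thesis .
  qed
  have A: "\<alpha> * vec_nth (vec_nth A j) k = vec_nth a j * vec_nth a k + s * (vec_nth b j * vec_nth b k)" for j k
    using assms(3)[of "axis j 1" "axis k 1"] by (simp add: matrix_form_axis inner_axis)
  have "\<alpha> * pairing \<beta> A = (\<Sum>j\<in>UNIV. \<Sum>k\<in>UNIV. entry \<beta> j k * (\<alpha> * vec_nth (vec_nth A j) k))"
    by (simp add: pairing_def sum_distrib_left mult_ac)
  also have "\<dots> = \<beta> (a, a) + s * \<beta> (b, b)"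
    unfolding e A sum_distrib_left sum.distrib[symmetric] by (intro sum.cong refl) (simp add: algebra_simps)
  finally show ?thesis .
qed

subsection \<open>Real solutions\<close>

locale euclidean_forms =
  fixes ix :: "nat \<Rightarrow> 'n::finite" and m :: nat
  assumes m: "m \<ge> 1" and ix: "bij_betw ix {..m} UNIV"
begin

text \<open>A vector is read as the values at \<open>0, ..., m\<close> of a polynomial of degree at
  most \<open>m\<close>, and \<open>L i\<close> is the value at \<open>i\<close>. General position
  then is Lagrange interpolation: any \<open>m + 1\<close> values determine the others.\<close>

definition L :: "nat \<Rightarrow> real ^ 'n \<Rightarrow> real" where
  "L i x = poly (\<Sum>k\<le>m. Polynomial.smult (vec_nth x (ix k)) (lagrange_poly {..m} k)) (real i)"

lemma L_value: "i \<le> m \<Longrightarrow> L i x = vec_nth x (ix i)"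
  by (simp add: L_def poly_sum poly_lagrange_poly if_distrib[of "\<lambda>x. _ * x"] cong: if_cong)

lemma L_linear: "linear (L i)"
  by (rule linearI) (simp_all add: L_def poly_sum sum.distrib algebra_simps sum_distrib_left)

sublocale forms L m
proof
  show "m \<ge> 1" by (rule m)
next
  fix K i assume K: "K \<subseteq> {..2 * m}" "card K = Suc m" "i \<le> 2 * m"
  then have fK: "finite K" using finite_subset by blast
  have "L i x = (\<Sum>k\<in>K. poly (lagrange_poly K k) (real i) * L k x)" for x
    unfolding L_def
    by (rule lagrange_interpolation[OF fK K(2)])
      (intro degree_sum_le order_trans[OF degree_smult_le] degree_lagrange_poly; simp)
  then have "L i = (\<Sum>k\<in>K. poly (lagrange_poly K k) (real i) *\<^sub>R L k)"
    by (simp add: fun_eq_iff sum_fun_apply)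
  also have "\<dots> \<in> span (L ` K)" by (intro span_sum span_scale span_base) auto
  finally show "L i \<in> span (L ` K)" .
next
  fix f :: "nat \<Rightarrow> real"
  have "L i (vec_lambda (\<lambda>j. f (inv_into {..m} ix j))) = f i" if "i \<le> m" for i
    using that ix by (simp add: L_value bij_betw_def inv_into_f_f)
  then show "\<exists>x. \<forall>i\<le>m. L i x = f i" by blast
qed

lemma coord_V: "coord j \<in> V 1"
proof -
  have "j \<in> ix ` {..m}" using ix by (simp add: bij_betw_def)
  then obtain i where i: "i \<le> m" "ix i = j" by auto
  then have "coord j = L i" by (intro ext) (simp add: coord_def L_value[OF i(1)] i(2))
  then show ?thesis using i L_V[of i] by simp
qed

lemma inner_V: "(\<bullet>) u \<in> V 1"
proof -
  have "(\<bullet>) u = (\<Sum>j\<in>UNIV. vec_nth u j *\<^sub>R coord j)"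
    by (auto simp: fun_eq_iff sum_fun_apply inner_vec_def coord_def)
  also have "\<dots> \<in> V 1" by (intro subspace_sum[OF V_subspace] subspace_scale[OF V_subspace] coord_V)
  finally show ?thesis .
qed

lemma symmetric_bilinear_S: "symmetric_bilinear \<beta> \<Longrightarrow> \<beta> \<in> S 1"
  by (subst symmetric_bilinear_expand, assumption)
    (intro subspace_sum[OF S_subspace] subspace_scale[OF S_subspace] sprod_S coord_V)

lemma symmetric_bilinear_H: "symmetric_bilinear (H i)"
  using L_linear[of i] by (auto simp: symmetric_bilinear_def H_def linear_iff algebra_simps)

text \<open>A multiplicative \<open>lam\<close> carries polynomial identities between symmetrised
  products over to its values \<open>lam 1 (sprod (coord j) (coord k))\<close>, which are the
  entries of \<open>A\<close>.\<close>

lemma character_matrix: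
  fixes lam :: "nat \<Rightarrow> ((real ^ 'n) \<times> (real ^ 'n) \<Rightarrow> real) \<Rightarrow> real"
  assumes add: "\<And>k f g. k \<ge> 1 \<Longrightarrow> f \<in> S k \<Longrightarrow> g \<in> S k \<Longrightarrow> lam k (f + g) = lam k f + lam k g"
    and scale: "\<And>k f c. k \<ge> 1 \<Longrightarrow> f \<in> S k \<Longrightarrow> lam k (c *\<^sub>R f) = c * lam k f"
    and mult: "\<And>j k f g. j \<ge> 1 \<Longrightarrow> k \<ge> 1 \<Longrightarrow> f \<in> S j \<Longrightarrow> g \<in> S k \<Longrightarrow> lam (j + k) (f * g) = lam j f * lam k g"
  obtains A where "rank2 A" "\<And>\<beta>. symmetric_bilinear \<beta> \<Longrightarrow> lam 1 \<beta> = pairing \<beta> A / 2"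
proof -
  define A :: "real ^ 'n ^ 'n" where "A = vec_lambda (\<lambda>j. vec_lambda (\<lambda>k. lam 1 (sprod (coord j) (coord k))))"
  have lam0: "lam 1 0 = 0" using scale[of 1 0 0] S_subspace by (simp add: subspace_0)
  have lam_sum: "lam 1 (\<Sum>i\<in>J. f i) = (\<Sum>i\<in>J. lam 1 (f i))" if "finite J" "\<And>i. i \<in> J \<Longrightarrow> f i \<in> S 1"
    for J :: "'n set" and f
    using that
  proof (induction J rule: finite_induct)
    case empty
    show ?case using lam0 by (simp only: sum.empty)
  next
    case (insert x F)
    have "(\<Sum>i\<in>F. f i) \<in> S 1" using insert by (intro subspace_sum[OF S_subspace]) auto
    then have "lam 1 (f x + (\<Sum>i\<in>F. f i)) = lam 1 (f x) + lam 1 (\<Sum>i\<in>F. f i)"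
      using insert by (intro add) auto
    moreover have "lam 1 (\<Sum>i\<in>F. f i) = (\<Sum>i\<in>F. lam 1 (f i))" using insert by blast
    ultimately show ?case unfolding sum.insert[OF insert(1,2)] by (simp only:)
  qed
  have lam_double: "lam 1 (\<Sum>j\<in>UNIV. \<Sum>k\<in>UNIV. c j k *\<^sub>R sprod (coord j) (coord k))
      = (\<Sum>j\<in>UNIV. \<Sum>k\<in>UNIV. c j k * vec_nth (vec_nth A j) k)" for c
  proof -
    have s: "c j k *\<^sub>R sprod (coord j) (coord k) \<in> S 1" for j k
      by (intro subspace_scale[OF S_subspace] sprod_S coord_V)
    have "lam 1 (\<Sum>j\<in>UNIV. \<Sum>k\<in>UNIV. c j k *\<^sub>R sprod (coord j) (coord k))
        = (\<Sum>j\<in>UNIV. \<Sum>k\<in>UNIV. lam 1 (c j k *\<^sub>R sprod (coord j) (coord k)))"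
    proof -
      have "lam 1 (\<Sum>k\<in>UNIV. c j k *\<^sub>R sprod (coord j) (coord k)) = (\<Sum>k\<in>UNIV. lam 1 (c j k *\<^sub>R sprod (coord j) (coord k)))" for j
        by (intro lam_sum finite s)
      moreover have "lam 1 (\<Sum>j\<in>UNIV. \<Sum>k\<in>UNIV. c j k *\<^sub>R sprod (coord j) (coord k))
          = (\<Sum>j\<in>UNIV. lam 1 (\<Sum>k\<in>UNIV. c j k *\<^sub>R sprod (coord j) (coord k)))"
        by (intro lam_sum finite subspace_sum[OF S_subspace] s)
      ultimately show ?thesis by (simp only:)
    qed
    also have "\<dots> = (\<Sum>j\<in>UNIV. \<Sum>k\<in>UNIV. c j k * vec_nth (vec_nth A j) k)"
    proof (intro sum.cong refl)
      fix j k
      show "lam 1 (c j k *\<^sub>R sprod (coord j) (coord k)) = c j k * vec_nth (vec_nth A j) k"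
        using scale[OF order_refl sprod_S[OF coord_V coord_V], of "c j k" j k] by (simp add: A_def)
    qed
    finally show ?thesis .
  qed
  have mA: "matrix_form A u v = lam 1 (sprod ((\<bullet>) u) ((\<bullet>) v))" for u v
  proof -
    have "sprod ((\<bullet>) u) ((\<bullet>) v) = (\<Sum>j\<in>UNIV. \<Sum>k\<in>UNIV. (vec_nth u j * vec_nth v k) *\<^sub>R sprod (coord j) (coord k))"
    proof
      fix p :: "(real ^ 'n) \<times> (real ^ 'n)"
      obtain x y where p: "p = (x, y)" by (cases p)
      have "sprod ((\<bullet>) u) ((\<bullet>) v) (x, y) = (\<Sum>j\<in>UNIV. \<Sum>k\<in>UNIV. vec_nth u j * vec_nth x j * (vec_nth v k * vec_nth y k))
        + (\<Sum>j\<in>UNIV. \<Sum>k\<in>UNIV. vec_nth u j * vec_nth y j * (vec_nth v k * vec_nth x k))"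
        by (simp add: sprod_def inner_vec_def sum_product)
      also have "\<dots> = (\<Sum>j\<in>UNIV. \<Sum>k\<in>UNIV. (vec_nth u j * vec_nth v k) *\<^sub>R sprod (coord j) (coord k)) (x, y)"
        unfolding sum_fun_apply sum.distrib[symmetric]
        by (intro sum.cong refl) (simp add: sprod_def coord_def algebra_simps)
      finally show "sprod ((\<bullet>) u) ((\<bullet>) v) p = (\<Sum>j\<in>UNIV. \<Sum>k\<in>UNIV. (vec_nth u j * vec_nth v k) *\<^sub>R sprod (coord j) (coord k)) p"
        by (simp only: p)
    qed
    then show ?thesis by (simp only: lam_double matrix_form_def)
  qed
  have "rank2 A"
    unfolding rank2_def
  proof (intro conjI allI)
    show "matrix_form A u v = matrix_form A v u" for u v
      unfolding mA by (subst sprod_commute) (rule refl)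
  next
    fix \<xi> u v u' v' :: "real ^ 'n"
    define f :: "real ^ 'n \<Rightarrow> real ^ 'n \<Rightarrow> (real ^ 'n) \<times> (real ^ 'n) \<Rightarrow> real"
      where "f u v = sprod ((\<bullet>) \<xi>) ((\<bullet>) \<xi>) * sprod ((\<bullet>) u) ((\<bullet>) v) + (- 1) *\<^sub>R (sprod ((\<bullet>) \<xi>) ((\<bullet>) u) * sprod ((\<bullet>) \<xi>) ((\<bullet>) v))" for u v
    have s: "sprod ((\<bullet>) u) ((\<bullet>) v) \<in> S 1" for u v :: "real ^ 'n" by (intro sprod_S inner_V)
    have ss: "sprod ((\<bullet>) u) ((\<bullet>) v) * sprod ((\<bullet>) u') ((\<bullet>) v') \<in> S 2" for u v u' v'
      using S_mult[OF s s] by (simp only: one_add_one)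
    have f: "f u v \<in> S 2" for u v
      unfolding f_def by (intro subspace_add[OF S_subspace] subspace_scale[OF S_subspace] ss)
    have m1: "lam 2 (sprod ((\<bullet>) u) ((\<bullet>) v) * sprod ((\<bullet>) u') ((\<bullet>) v')) = matrix_form A u v * matrix_form A u' v'" for u v u' v'
      using mult[OF order_refl order_refl s s] unfolding mA by (simp only: one_add_one)
    have lf: "lam 2 (f u v) = bordered_minor A \<xi> u v" for u v
    proof -
      have "lam 2 (f u v) = lam 2 (sprod ((\<bullet>) \<xi>) ((\<bullet>) \<xi>) * sprod ((\<bullet>) u) ((\<bullet>) v))
          + lam 2 ((- 1) *\<^sub>R (sprod ((\<bullet>) \<xi>) ((\<bullet>) u) * sprod ((\<bullet>) \<xi>) ((\<bullet>) v)))"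
        unfolding f_def by (rule add[OF _ ss subspace_scale[OF S_subspace ss]]) simp
      also have "lam 2 ((- 1) *\<^sub>R (sprod ((\<bullet>) \<xi>) ((\<bullet>) u) * sprod ((\<bullet>) \<xi>) ((\<bullet>) v)))
          = (- 1) * lam 2 (sprod ((\<bullet>) \<xi>) ((\<bullet>) u) * sprod ((\<bullet>) \<xi>) ((\<bullet>) v))"
        by (rule scale[OF _ ss]) simp
      finally show ?thesis
        unfolding m1[of \<xi> \<xi> u v] m1[of \<xi> u \<xi> v] bordered_minor_def by simp
    qed
    \<comment> \<open>At \<open>(x, y)\<close> the value of \<open>f u v\<close> is minus
      \<open>g u * g v\<close>, where \<open>g u = (\<xi> \<bullet> x) * (u \<bullet> y) - (\<xi>
      \<bullet> y) * (u \<bullet> x)\<close>; hence \<open>v\<close> and \<open>v'\<close> may be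
      exchanged.\<close>
    have "f u v * f u' v' = f u v' * f u' v"
      by (simp add: f_def sprod_def fun_eq_iff algebra_simps)
    then have "lam (2 + 2) (f u v * f u' v') = lam (2 + 2) (f u v' * f u' v)" by (simp only:)
    then have "lam 2 (f u v) * lam 2 (f u' v') = lam 2 (f u v') * lam 2 (f u' v)"
      by (subst (asm) (1 2) mult) (auto intro: f)
    then show "bordered_minor A \<xi> u v * bordered_minor A \<xi> u' v' = bordered_minor A \<xi> u v' * bordered_minor A \<xi> u' v"
      by (simp only: lf)
  qed
  moreover have "lam 1 \<beta> = pairing \<beta> A / 2" if "symmetric_bilinear \<beta>" for \<beta>
  proof -
    have "lam 1 \<beta> = lam 1 (\<Sum>j\<in>UNIV. \<Sum>k\<in>UNIV. (entry \<beta> j k / 2) *\<^sub>R sprod (coord j) (coord k))"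
      using symmetric_bilinear_expand[OF that] by (rule arg_cong)
    also have "\<dots> = pairing \<beta> A / 2"
      unfolding lam_double pairing_def by (simp add: sum_divide_distrib)
    finally show ?thesis .
  qed
  ultimately show thesis by (rule that)
qed

lemma annihilating_matrix:
  fixes P :: "nat \<Rightarrow> (real ^ 'n) \<times> (real ^ 'n) \<Rightarrow> real"
  assumes P: "\<And>i. i < 2 * m \<Longrightarrow> symmetric_bilinear (P i)" and e: "2 * e = (2 * m) choose m" "odd e"
  obtains A where "rank2 A" "A \<noteq> 0" "\<And>i. i < 2 * m \<Longrightarrow> pairing (P i) A = 0"
proof -
  \<comment> \<open>Solutions are rescaled to norm one: normalised by
    \<open>lam 1 (H (2 * m)) = 1\<close> they might be unbounded as \<open>t\<close> tends to zero,
    whereas a limit on the unit sphere exists and is nonzero.\<close>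
  define good where "good t \<longleftrightarrow> (\<exists>A. rank2 A \<and> norm A = 1 \<and> (\<forall>i<2 * m. t * pairing (H i) A + pairing (P i) A = 0))" for t
  have "finite {t. \<not> good t}"
  proof (rule finite_subset[OF _ generic_character[OF _ e, of P]], rule subsetI, rule ccontr)
    fix t assume t: "t \<in> {t. \<not> good t}"
    assume "t \<notin> {t. \<not> (\<exists>lam :: nat \<Rightarrow> ((real ^ 'n) \<times> (real ^ 'n) \<Rightarrow> real) \<Rightarrow> real.
      (\<forall>k\<ge>1. \<forall>f\<in>S k. \<forall>g\<in>S k. lam k (f + g) = lam k f + lam k g) \<and>
      (\<forall>k\<ge>1. \<forall>f\<in>S k. \<forall>c. lam k (c *\<^sub>R f) = c * lam k f) \<and>
      (\<forall>j\<ge>1. \<forall>k\<ge>1. \<forall>f\<in>S j. \<forall>g\<in>S k. lam (j + k) (f * g) = lam j f * lam k g) \<and>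
      (\<forall>i<2 * m. lam 1 (t *\<^sub>R H i + P i) = 0) \<and> lam 1 (H (2 * m)) = 1)}"
    then obtain lam :: "nat \<Rightarrow> ((real ^ 'n) \<times> (real ^ 'n) \<Rightarrow> real) \<Rightarrow> real" where
      lam: "\<forall>k\<ge>1. \<forall>f\<in>S k. \<forall>g\<in>S k. lam k (f + g) = lam k f + lam k g"
        "\<forall>k\<ge>1. \<forall>f\<in>S k. \<forall>c. lam k (c *\<^sub>R f) = c * lam k f"
        "\<forall>j\<ge>1. \<forall>k\<ge>1. \<forall>f\<in>S j. \<forall>g\<in>S k. lam (j + k) (f * g) = lam j f * lam k g"
      and lam0: "\<forall>i<2 * m. lam 1 (t *\<^sub>R H i + P i) = 0" "lam 1 (H (2 * m)) = 1" by blast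
    obtain A where A: "rank2 A" "\<And>\<beta>. symmetric_bilinear \<beta> \<Longrightarrow> lam 1 \<beta> = pairing \<beta> A / 2"
      by (rule character_matrix[of lam]) (use lam in blast)+
    have "A \<noteq> 0" using A(2)[OF symmetric_bilinear_H[of "2 * m"]] lam0(2) by (auto simp: pairing_def)
    have "t * pairing (H i) A + pairing (P i) A = 0" if "i < 2 * m" for i
      using A(2)[OF symmetric_bilinear_add[OF symmetric_bilinear_scale[OF symmetric_bilinear_H, of t i] P[OF that]]] lam0(1) that
      by (simp add: pairing_add pairing_scale_left)
    then have "t * pairing (H i) ((1 / norm A) *\<^sub>R A) + pairing (P i) ((1 / norm A) *\<^sub>R A) = 0" if "i < 2 * m" for i
      using that unfolding pairing_scale
      by (metis (no_types, opaque_lifting) distrib_left mult.left_commute mult_zero_right)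
    moreover have "norm ((1 / norm A) *\<^sub>R A) = 1" using \<open>A \<noteq> 0\<close> by simp
    ultimately have "good t" unfolding good_def using rank2_scale[OF A(1)] by blast
    then show False using t by simp
  qed (use P symmetric_bilinear_S in blast)
  then have "\<exists>t. 0 < t \<and> t < 1 / real (Suc n) \<and> good t" for n
  proof -
    assume fin: "finite {t. \<not> good t}"
    have "infinite {0<..<1 / real (Suc n)}" by (rule infinite_Ioo) simp
    then have "infinite ({0<..<1 / real (Suc n)} - {t. \<not> good t})" using fin by (rule Diff_infinite_finite[rotated])
    then have "{0<..<1 / real (Suc n)} - {t. \<not> good t} \<noteq> {}" by (rule infinite_imp_nonempty)
    then obtain t where "t \<in> {0<..<1 / real (Suc n)} - {t. \<not> good t}" by blast
    then show ?thesis by auto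
  qed
  then obtain t where t: "\<And>n. 0 < t n" "\<And>n. t n < 1 / real (Suc n)" "\<And>n. good (t n)" by metis
  then obtain X where X: "\<And>n. rank2 (X n)" "\<And>n. norm (X n) = 1"
    "\<And>n i. i < 2 * m \<Longrightarrow> t n * pairing (H i) (X n) + pairing (P i) (X n) = 0"
    unfolding good_def by metis
  have "compact (sphere (0 :: real ^ 'n ^ 'n) 1)" by (rule compact_sphere)
  moreover have "\<forall>n. X n \<in> sphere 0 1" using X(2) by simp
  ultimately obtain A r where A: "A \<in> sphere 0 1" "strict_mono r" "(X \<circ> r) \<longlonglongrightarrow> A"
    unfolding compact_def by blast
  have t0: "t \<longlonglongrightarrow> 0"
  proof (rule tendsto_sandwich)
    show "eventually (\<lambda>n. 0 \<le> t n) sequentially" by (intro always_eventually allI less_imp_le t(1))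
    show "eventually (\<lambda>n. t n \<le> 1 / real (Suc n)) sequentially" by (intro always_eventually allI less_imp_le t(2))
    show "(\<lambda>n. 1 / real (Suc n)) \<longlonglongrightarrow> 0" by (rule LIMSEQ_Suc) (rule lim_1_over_n)
  qed simp
  have tr: "(t \<circ> r) \<longlonglongrightarrow> 0" by (rule LIMSEQ_subseq_LIMSEQ[OF t0 A(2)])
  have XA: "(\<lambda>n. X (r n)) \<longlonglongrightarrow> A" using A(3) by (simp add: comp_def)
  show thesis
  proof
    show "rank2 A" using rank2_limit[OF XA] X(1) by blast
    show "A \<noteq> 0" using A(1) by auto
    fix i assume i: "i < 2 * m"
    have "(\<lambda>n. t (r n) * pairing (H i) (X (r n)) + pairing (P i) (X (r n))) \<longlonglongrightarrow> 0 * pairing (H i) A + pairing (P i) A"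
      using tr by (intro tendsto_intros tendsto_pairing XA) (simp add: comp_def)
    then have "(\<lambda>n. 0 :: real) \<longlonglongrightarrow> pairing (P i) A" using X(3)[OF i] by simp
    then show "pairing (P i) A = 0" by (simp add: LIMSEQ_const_iff)
  qed
qed

end

section \<open>From the annihilated matrix to two indistinguishable vectors\<close>

lemma orthogonal_projection_facts:
  fixes P :: "'a::euclidean_space \<Rightarrow> 'a"
  assumes "orthogonal_projection_onto S P"
  shows "linear P" "P x \<bullet> y = P x \<bullet> P y"
proof -
  have S: "subspace S" and 1: "P x \<in> S" "x - P x \<in> orthogonal_comp S" for x
    using assms by (auto simp: orthogonal_projection_onto_def)
  show "linear P"
  proof (rule linearI)
    fix x y c
    have "(x - P x) + (y - P y) \<in> orthogonal_comp S"
      using 1 by (intro subspace_add[OF subspace_orthogonal_comp])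
    then show "P (x + y) = P x + P y"
      using 1 S by (intro orthogonal_projection_onto_unique[OF assms]) (auto simp: subspace_add add_diff_add)
    have "c *\<^sub>R (x - P x) \<in> orthogonal_comp S"
      using 1 by (intro subspace_scale[OF subspace_orthogonal_comp])
    then show "P (c *\<^sub>R x) = c *\<^sub>R P x"
      using 1 S by (intro orthogonal_projection_onto_unique[OF assms]) (auto simp: subspace_scale scaleR_diff_right)
  qed
  have "P x \<bullet> (y - P y) = 0"
    using 1(1)[of x] 1(2)[of y] by (auto simp: orthogonal_comp_def real_inner_class.orthogonal_def)
  then show "P x \<bullet> y = P x \<bullet> P y" by (simp add: inner_diff_right)
qed

lemma not_injective_measurements:
  assumes "\<And>P. P \<in> set \<Phi> \<Longrightarrow> \<exists>S. orthogonal_projection_onto S P"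
    and "a \<noteq> 0" "b \<noteq> 0" "b \<noteq> a" "b \<noteq> - a" "\<And>P. P \<in> set \<Phi> \<Longrightarrow> P a \<bullet> P a = P b \<bullet> P b"
  shows "\<not> inj_on (measurement_map \<Phi>) nonzero_mod_pm"
proof
  assume inj: "inj_on (measurement_map \<Phi>) nonzero_mod_pm"
  have mem: "pm_rel `` {x} \<in> nonzero_mod_pm" if "x \<noteq> 0" for x :: 'a
    using that by (auto simp: nonzero_mod_pm_def intro!: quotientI)
  have "norm_measurements \<Phi> a = norm_measurements \<Phi> b"
    using assms(6) by (auto simp: norm_measurements_def)
  then have "measurement_map \<Phi> (pm_rel `` {a}) = measurement_map \<Phi> (pm_rel `` {b})"
    using measurement_map_class[OF assms(1)] assms(2,3) by metis
  then have "pm_rel `` {a} = pm_rel `` {b}" using inj mem assms(2,3) by (meson inj_onD)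
  moreover have "b \<in> pm_rel `` {b}" using assms(3) by (auto simp: pm_rel_def)
  ultimately have "b \<in> pm_rel `` {a}" by simp
  then show False using assms(4,5) by (auto simp: pm_rel_def)
qed

theorem theorem1p6:
  fixes k M N :: nat
    and \<Phi> :: "(real ^ 'n \<Rightarrow> real ^ 'n) list"
  assumes "M = 2 ^ k + 1"
    and "CARD('n) = M"
    and "length \<Phi> = N"
    and "N \<le> 2 * M - 2"
    and "\<And>P. P \<in> set \<Phi> \<Longrightarrow> \<exists>S. orthogonal_projection_onto S P \<and> S \<noteq> UNIV"
  shows "\<not> inj_on (measurement_map \<Phi>) nonzero_mod_pm"
proof -
  define m :: nat where "m = 2 ^ k"
  have "card {..m} = CARD('n)" using assms(1,2) by (simp add: m_def)
  then obtain ix :: "nat \<Rightarrow> 'n" where ix: "bij_betw ix {..m} UNIV"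
    using finite_same_card_bij[of "{..m}" "UNIV :: 'n set"] by auto
  interpret euclidean_forms ix m
    by unfold_locales (simp add: m_def, rule ix)
  obtain e where e: "2 * e = (2 * m) choose m" "odd e"
    by (rule half_central_binomial_odd[of k, folded m_def])
  have proj: "linear P" "P x \<bullet> y = P x \<bullet> P y" if "P \<in> set \<Phi>" for P x y
    using assms(5)[OF that] orthogonal_projection_facts by blast+
  \<comment> \<open>Padding with zero forms brings the system to exactly
    \<open>2 * m = 2 * M - 2\<close> members.\<close>
  define Q where "Q i = (if i < N then (\<lambda>(x, y). (\<Phi> ! i) x \<bullet> y) else 0)" for i
  have sblP: "symmetric_bilinear (\<lambda>(x, y). P x \<bullet> y)" if "P \<in> set \<Phi>" for P
  proof -
    have "P x \<bullet> y = P y \<bullet> x" for x y using proj(2)[OF that] by (metis inner_commute)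
    then show ?thesis by (auto simp: symmetric_bilinear_def linear_iff inner_add_right)
  qed
  have sblQ: "symmetric_bilinear (Q i)" for i
  proof (cases "i < N")
    case True
    then show ?thesis using sblP[of "\<Phi> ! i"] assms(3) by (simp only: Q_def if_True nth_mem)
  next
    case False
    then show ?thesis by (simp add: Q_def symmetric_bilinear_def linear_zero)
  qed
  obtain A where A: "rank2 A" "A \<noteq> 0" "\<And>i. i < 2 * m \<Longrightarrow> pairing (Q i) A = 0"
    by (rule annihilating_matrix[of Q, OF sblQ e]) (rule that; blast)
  obtain \<alpha> a b s where dec: "\<alpha> \<noteq> 0" "a \<noteq> 0"
    "\<And>u v. \<alpha> * matrix_form A u v = (a \<bullet> u) * (a \<bullet> v) + s * (b \<bullet> u) * (b \<bullet> v)"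
    by (rule rank2_decomposition[OF A(1,2)]) (rule that; blast)
  have eq: "P a \<bullet> P a + s * (P b \<bullet> P b) = 0" if P: "P \<in> set \<Phi>" for P
  proof -
    obtain i where i: "i < N" "P = \<Phi> ! i" using P assms(3) by (auto simp: in_set_conv_nth)
    then have "i < 2 * m" using assms(1,4) by (simp add: m_def)
    then have "0 = \<alpha> * pairing (Q i) A" using A(3) by simp
    also have "\<dots> = Q i (a, a) + s * Q i (b, b)" by (rule pairing_decomposition[OF sblQ dec(1,3)])
    finally show ?thesis using i proj(2)[OF P] by (simp add: Q_def)
  qed
  have ex: "\<exists>S. orthogonal_projection_onto S P" if "P \<in> set \<Phi>" for P using assms(5)[OF that] by blast
  show ?thesis
  proof (cases "\<forall>P \<in> set \<Phi>. P a \<bullet> P a = 0")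
    \<comment> \<open>Here every projection kills \<open>a\<close>, so \<open>a\<close> and
      \<open>2 *\<^sub>R a\<close> both have only zero measurements.\<close>
    case True
    have tripled: "2 *\<^sub>R a + 1 *\<^sub>R a = 3 *\<^sub>R a"
      unfolding scaleR_left_distrib[symmetric] by simp
    show ?thesis
    proof (rule not_injective_measurements[OF ex dec(2)])
      show "2 *\<^sub>R a \<noteq> 0" using dec(2) by simp
      show "2 *\<^sub>R a \<noteq> a" using dec(2) by (simp add: scaleR_2)
      show "2 *\<^sub>R a \<noteq> - a"
      proof
        assume "2 *\<^sub>R a = - a"
        then have "3 *\<^sub>R a = 0" unfolding tripled[symmetric] by simp
        then show False using dec(2) by simp
      qed
      fix P assume P: "P \<in> set \<Phi>"
      have "P a = 0" using True P by simp
      then show "P a \<bullet> P a = P (2 *\<^sub>R a) \<bullet> P (2 *\<^sub>R a)"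
        by (simp add: linear_scale[OF proj(1)[OF P]])
    qed
  next
    case False
    then obtain P0 where P0: "P0 \<in> set \<Phi>" "P0 a \<bullet> P0 a \<noteq> 0" by blast
    \<comment> \<open>Otherwise both terms of \<open>eq\<close> are nonnegative and
      \<open>P0 a\<close> would vanish.\<close>
    have "s < 0"
    proof (rule ccontr)
      assume "\<not> s < 0"
      then have "s * (P0 b \<bullet> P0 b) \<ge> 0" by simp
      then show False using eq[OF P0(1)] P0(2) inner_ge_zero[of "P0 a"] by linarith
    qed
    \<comment> \<open>Absorbing \<open>- s\<close> into the second vector turns \<open>eq\<close>
      into equality of two measurements.\<close>
    define c where "c = sqrt (- s) *\<^sub>R b"
    have dec': "\<alpha> * matrix_form A u v = (a \<bullet> u) * (a \<bullet> v) - (c \<bullet> u) * (c \<bullet> v)" for u v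
    proof -
      have "sqrt (- s) * sqrt (- s) = - s" using \<open>s < 0\<close> by simp
      moreover have "(c \<bullet> u) * (c \<bullet> v) = (sqrt (- s) * sqrt (- s)) * ((b \<bullet> u) * (b \<bullet> v))"
        unfolding c_def inner_scaleR_left by (simp only: mult_ac)
      ultimately have "(c \<bullet> u) * (c \<bullet> v) = - s * ((b \<bullet> u) * (b \<bullet> v))" by (simp only:)
      then show ?thesis using dec(3)[of u v] by simp
    qed
    have Pc: "P a \<bullet> P a = P c \<bullet> P c" if "P \<in> set \<Phi>" for P
    proof -
      have "P c \<bullet> P c = (sqrt (- s) * sqrt (- s)) * (P b \<bullet> P b)"
        unfolding c_def linear_scale[OF proj(1)[OF that]] inner_scaleR_left inner_scaleR_right
        by (simp only: mult_ac)
      then have "P c \<bullet> P c = - s * (P b \<bullet> P b)" using \<open>s < 0\<close> by simp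
      then show ?thesis using eq[OF that] by simp
    qed
    have nz: "\<exists>u v. matrix_form A u v \<noteq> 0"
    proof (rule ccontr)
      assume "\<not> ?thesis"
      then have "vec_nth (vec_nth A j) i = 0" for j i unfolding matrix_form_axis[symmetric] by blast
      then show False using A(2) by (simp add: Finite_Cartesian_Product.vec_eq_iff)
    qed
    \<comment> \<open>If \<open>c\<close> were \<open>a\<close> or \<open>- a\<close>, the
      right-hand side of \<open>dec'\<close> would vanish identically, against
      \<open>nz\<close>.\<close>
    have "c \<noteq> a" "c \<noteq> - a" using nz dec' dec(1) by auto
    have "c \<noteq> 0" using Pc[OF P0(1)] P0(2) linear_0[OF proj(1)[OF P0(1)]] by auto
    show ?thesis
      by (rule not_injective_measurements[where a = a and b = c]) (fact ex dec(2) Pc \<open>c \<noteq> 0\<close> \<open>c \<noteq> a\<close> \<open>c \<noteq> - a\<close>)+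
  qed
qed

end
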